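(* Let $\mathbf L$ be any substructural logic with $\mathbf{FL}_{\mathbf{ew}}\subseteq\mathbf L\subseteq\mathbf{IPL}$, and let ${\Rightarrow}\in\{\Rightarrow_{\wedge},\Rightarrow_{\circ}\}$. The following are equivalent: (1) $(\mathbf L,{\Rightarrow})$ is a connexive logic; (2) at least one of Aristotle's theses $\neg(\varphi{\Rightarrow}\neg\varphi)$, $\neg(\neg\varphi{\Rightarrow}\varphi)$ is a theorem (for all formulas $\varphi$) of $\mathbf L$; (3) $\mathbf L$ is an axiomatic extension of $\mathbf G_{\mathbf{FL}_{\mathbf{ew}}}(\mathbf{CPL})$.
   Context: Formulas are built from variables in the language $\{\wedge,\vee,\cdot,\to,0,1\}$; $\neg\varphi:=\varphi\to 0$, $\varphi\Rightarrow_{\wedge}\psi:=(\varphi\to\psi)\wedge(\psi\to\neg\neg\varphi)$, $\varphi\Rightarrow_{\circ}\psi:=(\varphi\to\psi)\cdot(\psi\to\neg\neg\varphi)$. $\mathbf{FL}_{\mathbf e}$ is the (external) logic of the Full Lambek calculus with exchange; substructural logics are its axiomatic extensions; $\mathbf{FL}_{\mathbf{ew}}$ is its extension by weakening. An FL${}_{\mathrm e}$-algebra is an algebra $\langle A,\wedge,\vee,\cdot,\to,0,1\rangle$ with a lattice reduct (order $\leq$), commutative monoid reduct $\langle A,\cdot,1\rangle$, arbitrary constant $0$, and $x\cdot y\leq z\iff x\leq y\to z$. Each substructural logic $\mathbf L$ is algebraizable with equivalent algebraic semantics a variety $\mathsf V(\mathbf L)$ of FL${}_{\mathrm e}$-algebras,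 with $\vdash_{\mathbf L}\varphi$ iff $\mathsf V(\mathbf L)\models 1\leq\varphi$; $\mathbf{FL}_{\mathbf{ew}}$ corresponds to FL${}_{\mathrm e}$-algebras with $1$ greatest and $0$ least, $\mathbf{IPL}$ to Heyting algebras, $\mathbf{CPL}$ to Boolean algebras. $\mathbf G_{\mathbf{FL}_{\mathbf e}}(\mathbf{CPL})$ is the least substructural logic $\mathbf K$ such that for every formula $\varphi$, $\vdash_{\mathbf{CPL}}\varphi$ iff $\vdash_{\mathbf K}\neg\neg\varphi$, and $\mathbf G_{\mathbf{FL}_{\mathbf{ew}}}(\mathbf{CPL})$ is the smallest substructural logic containing both $\mathbf G_{\mathbf{FL}_{\mathbf e}}(\mathbf{CPL})$ and $\mathbf{FL}_{\mathbf{ew}}$. For a term-defined binary connective ${\Rightarrow}$: $(\mathbf L,{\Rightarrow})$ is proto-connexive if every member of $\mathsf V(\mathbf L)$ satisfies, for all $x,y$, $1\leq\neg(x{\Rightarrow}\neg x)$, $1\leq\neg(\neg x{\Rightarrow} x)$, $1\leq (x{\Rightarrow} y){\Rightarrow}\neg(x{\Rightarrow}\neg y)$, $1\leq (x{\Rightarrow}\neg y){\Rightarrow}\neg(x{\Rightarrow} y)$, and connexive if moreover some member of $\mathsf V(\mathbf L)$ has elements $x,y$ with $x{\Rightarrow} y\neq y{\Rightarrow} x$. *)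

theory Defs
  imports "HOL-Library.Multiset" "HOL-Algebra.Group"
begin

section \<open>Formulas\<close>

datatype form =
    Var nat
  | And form form (infixr "\<sqdot>\<and>" 65)
  | Or form form (infixr "\<sqdot>\<or>" 60)
  | Fus form form (infixr "\<sqdot>\<cdot>" 70)
  | Imp form form (infixr "\<sqdot>\<rightarrow>" 55)
  | Zero
  | One

definition Neg :: "form \<Rightarrow> form" ("\<sqdot>\<not> _" [80] 80)
  where "\<sqdot>\<not> \<phi> = \<phi> \<sqdot>\<rightarrow> Zero"

definition imp_and :: "form \<Rightarrow> form \<Rightarrow> form" (infix "\<Rightarrow>\<^sub>\<and>" 55)
  where "\<phi> \<Rightarrow>\<^sub>\<and> \<psi> = (\<phi> \<sqdot>\<rightarrow> \<psi>) \<sqdot>\<and> (\<psi> \<sqdot>\<rightarrow> \<sqdot>\<not> \<sqdot>\<not> \<phi>)"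

definition imp_fus :: "form \<Rightarrow> form \<Rightarrow> form" (infix "\<Rightarrow>\<^sub>\<circ>" 55)
  where "\<phi> \<Rightarrow>\<^sub>\<circ> \<psi> = (\<phi> \<sqdot>\<rightarrow> \<psi>) \<sqdot>\<cdot> (\<psi> \<sqdot>\<rightarrow> \<sqdot>\<not> \<sqdot>\<not> \<phi>)"

primrec subst :: "(nat \<Rightarrow> form) \<Rightarrow> form \<Rightarrow> form" where
  "subst \<sigma> (Var n) = \<sigma> n"
| "subst \<sigma> (\<phi> \<sqdot>\<and> \<psi>) = subst \<sigma> \<phi> \<sqdot>\<and> subst \<sigma> \<psi>"
| "subst \<sigma> (\<phi> \<sqdot>\<or> \<psi>) = subst \<sigma> \<phi> \<sqdot>\<or> subst \<sigma> \<psi>"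
| "subst \<sigma> (\<phi> \<sqdot>\<cdot> \<psi>) = subst \<sigma> \<phi> \<sqdot>\<cdot> subst \<sigma> \<psi>"
| "subst \<sigma> (\<phi> \<sqdot>\<rightarrow> \<psi>) = subst \<sigma> \<phi> \<sqdot>\<rightarrow> subst \<sigma> \<psi>"
| "subst \<sigma> Zero = Zero"
| "subst \<sigma> One = One"

definition instances :: "form set \<Rightarrow> form set"
  where "instances Ax = {subst \<sigma> \<alpha> | \<sigma> \<alpha>. \<alpha> \<in> Ax}"

section \<open>The logic \<open>FL\<^sub>e\<close> and its axiomatic extensions\<close>

text \<open>
  The sequent calculus, with the members of \<open>\<Phi>\<close> as additional initial sequents (not closed under
  substitution). Exchange is built in, since antecedents are multisets; \<open>None\<close> is the empty
  succedent.
\<close>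

inductive FLe_seq :: "form set \<Rightarrow> form multiset \<Rightarrow> form option \<Rightarrow> bool" for \<Phi> where
  Hyp: "\<phi> \<in> \<Phi> \<Longrightarrow> FLe_seq \<Phi> {#} (Some \<phi>)"
| Id: "FLe_seq \<Phi> {#\<phi>#} (Some \<phi>)"
| Cut: "FLe_seq \<Phi> \<Gamma> (Some \<phi>) \<Longrightarrow> FLe_seq \<Phi> (add_mset \<phi> \<Delta>) \<delta> \<Longrightarrow> FLe_seq \<Phi> (\<Gamma> + \<Delta>) \<delta>"
| OneL: "FLe_seq \<Phi> \<Gamma> \<delta> \<Longrightarrow> FLe_seq \<Phi> (add_mset One \<Gamma>) \<delta>"
| OneR: "FLe_seq \<Phi> {#} (Some One)"
| ZeroL: "FLe_seq \<Phi> {#Zero#} None"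
| ZeroR: "FLe_seq \<Phi> \<Gamma> None \<Longrightarrow> FLe_seq \<Phi> \<Gamma> (Some Zero)"
| AndL1: "FLe_seq \<Phi> (add_mset \<phi> \<Gamma>) \<delta> \<Longrightarrow> FLe_seq \<Phi> (add_mset (\<phi> \<sqdot>\<and> \<psi>) \<Gamma>) \<delta>"
| AndL2: "FLe_seq \<Phi> (add_mset \<psi> \<Gamma>) \<delta> \<Longrightarrow> FLe_seq \<Phi> (add_mset (\<phi> \<sqdot>\<and> \<psi>) \<Gamma>) \<delta>"
| AndR: "FLe_seq \<Phi> \<Gamma> (Some \<phi>) \<Longrightarrow> FLe_seq \<Phi> \<Gamma> (Some \<psi>) \<Longrightarrow> FLe_seq \<Phi> \<Gamma> (Some (\<phi> \<sqdot>\<and> \<psi>))"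
| OrL: "FLe_seq \<Phi> (add_mset \<phi> \<Gamma>) \<delta> \<Longrightarrow> FLe_seq \<Phi> (add_mset \<psi> \<Gamma>) \<delta> \<Longrightarrow>
    FLe_seq \<Phi> (add_mset (\<phi> \<sqdot>\<or> \<psi>) \<Gamma>) \<delta>"
| OrR1: "FLe_seq \<Phi> \<Gamma> (Some \<phi>) \<Longrightarrow> FLe_seq \<Phi> \<Gamma> (Some (\<phi> \<sqdot>\<or> \<psi>))"
| OrR2: "FLe_seq \<Phi> \<Gamma> (Some \<psi>) \<Longrightarrow> FLe_seq \<Phi> \<Gamma> (Some (\<phi> \<sqdot>\<or> \<psi>))"
| FusL: "FLe_seq \<Phi> (add_mset \<phi> (add_mset \<psi> \<Gamma>)) \<delta> \<Longrightarrow> FLe_seq \<Phi> (add_mset (\<phi> \<sqdot>\<cdot> \<psi>) \<Gamma>) \<delta>"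
| FusR: "FLe_seq \<Phi> \<Gamma> (Some \<phi>) \<Longrightarrow> FLe_seq \<Phi> \<Delta> (Some \<psi>) \<Longrightarrow>
    FLe_seq \<Phi> (\<Gamma> + \<Delta>) (Some (\<phi> \<sqdot>\<cdot> \<psi>))"
| ImpL: "FLe_seq \<Phi> \<Gamma> (Some \<phi>) \<Longrightarrow> FLe_seq \<Phi> (add_mset \<psi> \<Delta>) \<delta> \<Longrightarrow>
    FLe_seq \<Phi> (add_mset (\<phi> \<sqdot>\<rightarrow> \<psi>) (\<Gamma> + \<Delta>)) \<delta>"
| ImpR: "FLe_seq \<Phi> (add_mset \<phi> \<Gamma>) (Some \<psi>) \<Longrightarrow> FLe_seq \<Phi> \<Gamma> (Some (\<phi> \<sqdot>\<rightarrow> \<psi>))"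

text \<open>
  Logics are identified with their consequence relations, so that inclusion of logics is the
  order \<open>\<le>\<close> on this type, and \<open>L {} \<phi>\<close> says that \<open>\<phi>\<close> is a theorem of \<open>L\<close>.
\<close>

type_synonym logic = "form set \<Rightarrow> form \<Rightarrow> bool"

definition FLe :: logic
  where "FLe \<Phi> \<phi> = FLe_seq \<Phi> {#} (Some \<phi>)"

definition add_axioms :: "logic \<Rightarrow> form set \<Rightarrow> logic"
  where "add_axioms K Ax \<Phi> \<phi> = K (\<Phi> \<union> instances Ax) \<phi>"

text \<open>\<open>axiomatic_extension K L\<close>: the larger logic \<open>L\<close> extends \<open>K\<close>.\<close>

definition axiomatic_extension :: "logic \<Rightarrow> logic \<Rightarrow> bool"
  where "axiomatic_extension K L \<longleftrightarrow> (\<exists>Ax. L = add_axioms K Ax)"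

definition substructural_logic :: "logic \<Rightarrow> bool"
  where "substructural_logic L \<longleftrightarrow> axiomatic_extension FLe L"

text \<open>The two axioms are the left and the right weakening rule.\<close>

definition FLew :: logic
  where "FLew = add_axioms FLe {Var 0 \<sqdot>\<rightarrow> One, Zero \<sqdot>\<rightarrow> Var 0}"

text \<open>
  In the presence of weakening, contraction makes \<open>\<cdot>\<close> and \<open>\<and>\<close> coincide, as they do in Heyting
  algebras.
\<close>

definition IPL :: logic
  where "IPL = add_axioms FLew {Var 0 \<sqdot>\<rightarrow> Var 0 \<sqdot>\<cdot> Var 0}"

definition CPL :: logic
  where "CPL = add_axioms IPL {\<sqdot>\<not> \<sqdot>\<not> Var 0 \<sqdot>\<rightarrow> Var 0}"

text \<open>
  Both least elements exist: the substructural logic axiomatized by the common theorems of all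
  candidates is again a candidate, and \<open>CPL\<close> is one.
\<close>

definition G_FLe_CPL :: logic
  where "G_FLe_CPL =
    (LEAST K. substructural_logic K \<and> (\<forall>\<phi>. CPL {} \<phi> \<longleftrightarrow> K {} (\<sqdot>\<not> \<sqdot>\<not> \<phi>)))"

definition G_FLew_CPL :: logic
  where "G_FLew_CPL = (LEAST K. substructural_logic K \<and> G_FLe_CPL \<le> K \<and> FLew \<le> K)"

section \<open>\<open>FL\<^sub>e\<close>-algebras\<close>

record 'a fle_struct = "'a monoid" +
  fl_meet :: "'a \<Rightarrow> 'a \<Rightarrow> 'a"
  fl_join :: "'a \<Rightarrow> 'a \<Rightarrow> 'a"
  fl_imp :: "'a \<Rightarrow> 'a \<Rightarrow> 'a"
  fl_zero :: 'a

definition fl_le :: "('a, 'b) fle_struct_scheme \<Rightarrow> 'a \<Rightarrow> 'a \<Rightarrow> bool" (infix "\<preceq>\<index>" 50)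
  where "x \<preceq>\<^bsub>A\<^esub> y \<longleftrightarrow> fl_meet A x y = x"

definition fl_neg :: "('a, 'b) fle_struct_scheme \<Rightarrow> 'a \<Rightarrow> 'a"
  where "fl_neg A x = fl_imp A x (fl_zero A)"

locale fle_algebra = comm_monoid A for A :: "('a, 'b) fle_struct_scheme" (structure) +
  assumes meet_closed: "\<lbrakk>x \<in> carrier A; y \<in> carrier A\<rbrakk> \<Longrightarrow> fl_meet A x y \<in> carrier A"
    and join_closed: "\<lbrakk>x \<in> carrier A; y \<in> carrier A\<rbrakk> \<Longrightarrow> fl_join A x y \<in> carrier A"
    and imp_closed: "\<lbrakk>x \<in> carrier A; y \<in> carrier A\<rbrakk> \<Longrightarrow> fl_imp A x y \<in> carrier A"
    and zero_closed: "fl_zero A \<in> carrier A"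
    and meet_comm: "\<lbrakk>x \<in> carrier A; y \<in> carrier A\<rbrakk> \<Longrightarrow> fl_meet A x y = fl_meet A y x"
    and join_comm: "\<lbrakk>x \<in> carrier A; y \<in> carrier A\<rbrakk> \<Longrightarrow> fl_join A x y = fl_join A y x"
    and meet_assoc: "\<lbrakk>x \<in> carrier A; y \<in> carrier A; z \<in> carrier A\<rbrakk> \<Longrightarrow>
      fl_meet A (fl_meet A x y) z = fl_meet A x (fl_meet A y z)"
    and join_assoc: "\<lbrakk>x \<in> carrier A; y \<in> carrier A; z \<in> carrier A\<rbrakk> \<Longrightarrow>
      fl_join A (fl_join A x y) z = fl_join A x (fl_join A y z)"
    and meet_join_absorb: "\<lbrakk>x \<in> carrier A; y \<in> carrier A\<rbrakk> \<Longrightarrow> fl_meet A x (fl_join A x y) = x"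
    and join_meet_absorb: "\<lbrakk>x \<in> carrier A; y \<in> carrier A\<rbrakk> \<Longrightarrow> fl_join A x (fl_meet A x y) = x"
    and residuation: "\<lbrakk>x \<in> carrier A; y \<in> carrier A; z \<in> carrier A\<rbrakk> \<Longrightarrow>
      x \<otimes> y \<preceq> z \<longleftrightarrow> x \<preceq> fl_imp A y z"

primrec fl_eval :: "('a, 'b) fle_struct_scheme \<Rightarrow> (nat \<Rightarrow> 'a) \<Rightarrow> form \<Rightarrow> 'a" where
  "fl_eval A v (Var n) = v n"
| "fl_eval A v (\<phi> \<sqdot>\<and> \<psi>) = fl_meet A (fl_eval A v \<phi>) (fl_eval A v \<psi>)"
| "fl_eval A v (\<phi> \<sqdot>\<or> \<psi>) = fl_join A (fl_eval A v \<phi>) (fl_eval A v \<psi>)"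
| "fl_eval A v (\<phi> \<sqdot>\<cdot> \<psi>) = fl_eval A v \<phi> \<otimes>\<^bsub>A\<^esub> fl_eval A v \<psi>"
| "fl_eval A v (\<phi> \<sqdot>\<rightarrow> \<psi>) = fl_imp A (fl_eval A v \<phi>) (fl_eval A v \<psi>)"
| "fl_eval A v Zero = fl_zero A"
| "fl_eval A v One = \<one>\<^bsub>A\<^esub>"

text \<open>
  The members of \<open>\<V> L\<close> whose carrier is a subset of the type \<open>'a\<close>.
\<close>

definition variety :: "logic \<Rightarrow> 'a fle_struct set" ("\<V>")
  where "\<V> L = {A. fle_algebra A \<and>
    (\<forall>\<phi>. L {} \<phi> \<longrightarrow> (\<forall>v. range v \<subseteq> carrier A \<longrightarrow> \<one>\<^bsub>A\<^esub> \<preceq>\<^bsub>A\<^esub> fl_eval A v \<phi>))}"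

section \<open>Connexivity\<close>

text \<open>
  A term-defined connective \<open>c\<close> acts on formulas by substitution into the term
  \<open>c (Var 0) (Var 1)\<close>; its interpretation in an algebra is the term operation of that term.
\<close>

definition fl_op :: "('a, 'b) fle_struct_scheme \<Rightarrow> (form \<Rightarrow> form \<Rightarrow> form) \<Rightarrow> 'a \<Rightarrow> 'a \<Rightarrow> 'a"
  where "fl_op A c x y = fl_eval A (\<lambda>n. if n = 0 then x else y) (c (Var 0) (Var 1))"

text \<open>
  Both notions below range over the algebras with carrier in \<open>'a\<close>. As there are only countably many
  formulas, they do not depend on \<open>'a\<close> as long as \<open>'a\<close> is infinite.
\<close>

definition proto_connexive :: "'a itself \<Rightarrow> logic \<Rightarrow> (form \<Rightarrow> form \<Rightarrow> form) \<Rightarrow> bool"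
  where "proto_connexive TYPE('a) L c \<longleftrightarrow>
    (\<forall>A \<in> (\<V> L :: 'a fle_struct set). \<forall>x \<in> carrier A. \<forall>y \<in> carrier A.
      let imp = fl_op A c; neg = fl_neg A in
        \<one>\<^bsub>A\<^esub> \<preceq>\<^bsub>A\<^esub> neg (imp x (neg x)) \<and>
        \<one>\<^bsub>A\<^esub> \<preceq>\<^bsub>A\<^esub> neg (imp (neg x) x) \<and>
        \<one>\<^bsub>A\<^esub> \<preceq>\<^bsub>A\<^esub> imp (imp x y) (neg (imp x (neg y))) \<and>
        \<one>\<^bsub>A\<^esub> \<preceq>\<^bsub>A\<^esub> imp (imp x (neg y)) (neg (imp x y)))"

definition connexive :: "'a itself \<Rightarrow> logic \<Rightarrow> (form \<Rightarrow> form \<Rightarrow> form) \<Rightarrow> bool"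
  where "connexive TYPE('a) L c \<longleftrightarrow> proto_connexive TYPE('a) L c \<and>
    (\<exists>A \<in> (\<V> L :: 'a fle_struct set). \<exists>x \<in> carrier A. \<exists>y \<in> carrier A.
      fl_op A c x y \<noteq> fl_op A c y x)"

end

theory Submission
  imports Defs "HOL-Library.Countable" "HOL-Library.Extended_Nat"
begin

text \<open>
  All three conditions are equivalent to Glivenko's property: \<open>L\<close> refutes every formula that is
  unsatisfiable over the two-element chain. If \<open>\<phi>, \<phi> \<Rightarrow>\<close> is derivable, then \<open>\<phi>\<close> entails both
  \<open>\<phi> \<Rightarrow> \<not>\<phi>\<close> and \<open>\<not>\<not>\<phi> \<Rightarrow> \<not>\<phi>\<close>, so either of Aristotle's theses gives \<open>\<phi> \<Rightarrow>\<close>. Hence refutability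
  in \<open>L\<close> admits contraction as well as weakening, and unsatisfiable formulas are refuted by deciding
  their variables one by one, as in Kalmar's completeness proof. Conversely, each thesis amounts to
  refutations of unsatisfiable formulas, because \<open>\<alpha> \<rightarrow> \<not>\<beta>\<close> says that \<open>\<alpha> \<cdot> \<beta>\<close> is refuted. The least
  logic \<open>G(CPL)\<close> is axiomatized by the double negations of the classical tautologies, which over
  \<open>FL\<^sub>e\<^sub>w\<close> is Glivenko's property. A Lindenbaum algebra injected into \<open>'a\<close> turns validity in \<open>\<V> L\<close>
  into derivability; it also shows that the implication is not symmetric, since a chain with more
  than two elements refutes symmetry in \<open>IPL\<close>.
\<close>

section \<open>The sequent calculus\<close>

text \<open>Every \<open>Hyp\<close> leaf is replaced by a derivation of the same sequent from
  \<open>\<Psi>\<close>. This transfers derivations between axiom sets.\<close>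

lemma FLe_seq_theory:
  assumes "FLe_seq \<Phi> \<Gamma> \<delta>" "\<And>\<phi>. \<phi> \<in> \<Phi> \<Longrightarrow> FLe_seq \<Psi> {#} (Some \<phi>)"
  shows "FLe_seq \<Psi> \<Gamma> \<delta>"
  using assms by (induction rule: FLe_seq.induct) (auto intro: FLe_seq.intros)

lemma FLe_seq_mono: "FLe_seq \<Phi> \<Gamma> \<delta> \<Longrightarrow> \<Phi> \<subseteq> \<Psi> \<Longrightarrow> FLe_seq \<Psi> \<Gamma> \<delta>"
  by (rule FLe_seq_theory) (auto intro: FLe_seq.Hyp)

lemma FLe_seq_subst:
  "FLe_seq \<Phi> \<Gamma> \<delta> \<Longrightarrow>
    FLe_seq (subst \<sigma> ` \<Phi>) (image_mset (subst \<sigma>) \<Gamma>) (map_option (subst \<sigma>) \<delta>)"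
  by (induction rule: FLe_seq.induct) (auto intro: FLe_seq.intros)

section \<open>Invertible rules, each reversed by a cut against a derivable sequent\<close>

lemma seq_imp [simp]:
  "FLe_seq \<Psi> \<Gamma> (Some (\<phi> \<sqdot>\<rightarrow> \<psi>)) \<longleftrightarrow> FLe_seq \<Psi> (add_mset \<phi> \<Gamma>) (Some \<psi>)"
proof
  have "FLe_seq \<Psi> (add_mset (\<phi> \<sqdot>\<rightarrow> \<psi>) {#\<phi>#}) (Some \<psi>)"
    using FLe_seq.ImpL[OF FLe_seq.Id FLe_seq.Id, of \<Psi> \<phi> \<psi>] by simp
  then show "FLe_seq \<Psi> (add_mset \<phi> \<Gamma>) (Some \<psi>)" if "FLe_seq \<Psi> \<Gamma> (Some (\<phi> \<sqdot>\<rightarrow> \<psi>))"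
    using FLe_seq.Cut[OF that] by fastforce
qed (rule FLe_seq.ImpR)

lemma seq_zero [simp]: "FLe_seq \<Psi> \<Gamma> (Some Zero) \<longleftrightarrow> FLe_seq \<Psi> \<Gamma> None"
  using FLe_seq.Cut[of \<Psi> \<Gamma> Zero "{#}" None] by (auto intro: FLe_seq.intros)

lemma seq_neg [simp]: "FLe_seq \<Psi> \<Gamma> (Some (\<sqdot>\<not> \<phi>)) \<longleftrightarrow> FLe_seq \<Psi> (add_mset \<phi> \<Gamma>) None"
  by (simp add: Neg_def)

lemma seq_fus [simp]:
  "FLe_seq \<Psi> (add_mset (\<phi> \<sqdot>\<cdot> \<psi>) \<Gamma>) \<delta> \<longleftrightarrow> FLe_seq \<Psi> (add_mset \<phi> (add_mset \<psi> \<Gamma>)) \<delta>"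
proof
  have "FLe_seq \<Psi> {#\<phi>, \<psi>#} (Some (\<phi> \<sqdot>\<cdot> \<psi>))"
    using FLe_seq.FusR[OF FLe_seq.Id FLe_seq.Id, of \<Psi> \<phi> \<psi>] by (simp add: add_mset_commute)
  then show "FLe_seq \<Psi> (add_mset \<phi> (add_mset \<psi> \<Gamma>)) \<delta>" if "FLe_seq \<Psi> (add_mset (\<phi> \<sqdot>\<cdot> \<psi>) \<Gamma>) \<delta>"
    using FLe_seq.Cut that by fastforce
qed (rule FLe_seq.FusL)

lemma seq_one [simp]: "FLe_seq \<Psi> (add_mset One \<Gamma>) \<delta> \<longleftrightarrow> FLe_seq \<Psi> \<Gamma> \<delta>"
  using FLe_seq.Cut[OF FLe_seq.OneR] by (fastforce intro: FLe_seq.OneL)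

lemma seq_or [simp]:
  "FLe_seq \<Psi> (add_mset (\<phi> \<sqdot>\<or> \<psi>) \<Gamma>) \<delta> \<longleftrightarrow>
    FLe_seq \<Psi> (add_mset \<phi> \<Gamma>) \<delta> \<and> FLe_seq \<Psi> (add_mset \<psi> \<Gamma>) \<delta>"
  using FLe_seq.Cut[OF FLe_seq.OrR1[OF FLe_seq.Id[of \<Psi> \<phi>], of \<psi>], of \<Gamma> \<delta>]
    FLe_seq.Cut[OF FLe_seq.OrR2[OF FLe_seq.Id[of \<Psi> \<psi>], of \<phi>], of \<Gamma> \<delta>]
  by (auto intro: FLe_seq.OrL)

lemma seq_and [simp]:
  "FLe_seq \<Psi> \<Gamma> (Some (\<phi> \<sqdot>\<and> \<psi>)) \<longleftrightarrow> FLe_seq \<Psi> \<Gamma> (Some \<phi>) \<and> FLe_seq \<Psi> \<Gamma> (Some \<psi>)"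
  using FLe_seq.Cut[OF _ FLe_seq.AndL1[OF FLe_seq.Id], of \<Psi> \<Gamma> \<phi> \<psi>]
    FLe_seq.Cut[OF _ FLe_seq.AndL2[OF FLe_seq.Id], of \<Psi> \<Gamma> \<phi> \<psi>]
  by (auto intro: FLe_seq.AndR)

lemma seq_id2: "FLe_seq \<Psi> {#\<phi>, \<sqdot>\<not> \<phi>#} None" "FLe_seq \<Psi> {#\<sqdot>\<not> \<phi>, \<phi>#} None"
  using FLe_seq.Id[of \<Psi> "\<sqdot>\<not> \<phi>"] by (auto simp: add_mset_commute)

lemma seq_trans:
  "FLe_seq \<Psi> {#\<phi>#} (Some \<psi>) \<Longrightarrow> FLe_seq \<Psi> {#\<psi>#} \<delta> \<Longrightarrow> FLe_seq \<Psi> {#\<phi>#} \<delta>"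
  using FLe_seq.Cut[of \<Psi> "{#\<phi>#}" \<psi> "{#}" \<delta>] by simp

section \<open>Substructural logics\<close>

lemma instances_subst: "subst \<sigma> ` instances Ax \<subseteq> instances Ax"
proof -
  have "subst \<sigma> (subst \<tau> \<phi>) = subst (subst \<sigma> \<circ> \<tau>) \<phi>" for \<tau> \<phi>
    by (induction \<phi>) auto
  then show ?thesis unfolding instances_def by blast
qed

lemma instances_superset: "Ax \<subseteq> instances Ax"
proof -
  have "subst Var \<phi> = \<phi>" for \<phi>
    by (induction \<phi>) auto
  then show ?thesis unfolding instances_def by (metis (mono_tags, lifting) mem_Collect_eq subsetI)
qed

lemma instances_Un: "instances (A \<union> B) = instances A \<union> instances B"
  by (auto simp: instances_def)

lemma add_axioms_add_axioms: "add_axioms (add_axioms K A) B = add_axioms K (A \<union> B)"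
  by (auto simp: add_axioms_def fun_eq_iff instances_Un Un_ac)

lemma substructural_add_axioms: "substructural_logic (add_axioms FLe Ax)"
  unfolding substructural_logic_def axiomatic_extension_def by blast

lemma substructural_logic_iff:
  "substructural_logic L \<longleftrightarrow> (\<exists>Ax. \<forall>\<Phi> \<phi>. L \<Phi> \<phi> \<longleftrightarrow> FLe_seq (\<Phi> \<union> instances Ax) {#} (Some \<phi>))"
  unfolding substructural_logic_def axiomatic_extension_def add_axioms_def FLe_def fun_eq_iff by blast

text \<open>A substitution may be applied to a whole derivation, and the instances of the axioms are
  closed under it.\<close>

lemma theorem_subst:
  assumes "substructural_logic L" "L {} \<phi>"
  shows "L {} (subst \<sigma> \<phi>)"
proof -
  obtain Ax where Ax: "L \<Phi> \<phi> \<longleftrightarrow> FLe_seq (\<Phi> \<union> instances Ax) {#} (Some \<phi>)" for \<Phi> \<phi>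
    using assms(1) substructural_logic_iff by blast
  show ?thesis
    using assms(2) FLe_seq_subst[of "instances Ax" "{#}" "Some \<phi>" \<sigma>]
      FLe_seq_mono[OF _ instances_subst[of \<sigma> Ax]] unfolding Ax by simp
qed

text \<open>Theorems used as hypotheses can be replaced by their derivations. The set of all
  theorems thus stands in for an unknown axiomatization, and questions about \<open>L\<close> become
  questions about sequents.\<close>

lemma theorem_iff_seq:
  assumes "substructural_logic L"
  shows "L {} \<phi> \<longleftrightarrow> FLe_seq {\<psi>. L {} \<psi>} {#} (Some \<phi>)"
proof -
  obtain Ax where Ax: "L \<Phi> \<phi> \<longleftrightarrow> FLe_seq (\<Phi> \<union> instances Ax) {#} (Some \<phi>)" for \<Phi> \<phi>
    using assms(1) substructural_logic_iff by blast
  have "FLe_seq (instances Ax) {#} (Some \<phi>)" if "FLe_seq {\<psi>. L {} \<psi>} {#} (Some \<phi>)"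
    using that by (rule FLe_seq_theory) (simp add: Ax)
  then show ?thesis by (auto simp: Ax intro: FLe_seq.Hyp)
qed

text \<open>Hypotheses are merely added to the instances of the axioms, and each such instance is
  itself a theorem. Comparing theorems therefore decides inclusion of the consequence
  relations.\<close>

lemma logic_le_iff:
  assumes "substructural_logic L" "substructural_logic K"
  shows "L \<le> K \<longleftrightarrow> (\<forall>\<phi>. L {} \<phi> \<longrightarrow> K {} \<phi>)"
proof
  assume *: "\<forall>\<phi>. L {} \<phi> \<longrightarrow> K {} \<phi>"
  obtain Ax where Ax: "L \<Phi> \<phi> \<longleftrightarrow> FLe_seq (\<Phi> \<union> instances Ax) {#} (Some \<phi>)" for \<Phi> \<phi>
    using assms(1) substructural_logic_iff by blast
  obtain Bx where Bx: "K \<Phi> \<phi> \<longleftrightarrow> FLe_seq (\<Phi> \<union> instances Bx) {#} (Some \<phi>)" for \<Phi> \<phi>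
    using assms(2) substructural_logic_iff by blast
  have hyp: "FLe_seq (\<Phi> \<union> instances Bx) {#} (Some \<phi>)" if "\<phi> \<in> instances Ax" for \<Phi> \<phi>
  proof (rule FLe_seq_mono)
    have "L {} \<phi>" using that by (simp add: Ax FLe_seq.Hyp)
    then show "FLe_seq (instances Bx) {#} (Some \<phi>)" using * Bx[of "{}"] by simp
  qed simp
  have "K \<Phi> \<phi>" if "L \<Phi> \<phi>" for \<Phi> \<phi>
    using that unfolding Ax Bx by (rule FLe_seq_theory) (use hyp in \<open>auto intro: FLe_seq.Hyp\<close>)
  then show "L \<le> K" by auto
qed auto

text \<open>The theorems of \<open>K\<close> are closed under substitution, so the axioms alone have
  to be checked, without their instances.\<close>

lemma axioms_le_iff:
  assumes "substructural_logic K"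
  shows "add_axioms FLe Ax \<le> K \<longleftrightarrow> (\<forall>\<phi> \<in> Ax. K {} \<phi>)"
proof
  assume "add_axioms FLe Ax \<le> K"
  then show "\<forall>\<phi> \<in> Ax. K {} \<phi>"
    using instances_superset[of Ax] by (auto simp: le_fun_def add_axioms_def FLe_def intro: FLe_seq.Hyp)
next
  assume *: "\<forall>\<phi> \<in> Ax. K {} \<phi>"
  have sub: "substructural_logic (add_axioms FLe Ax)"
    by (rule substructural_add_axioms)
  have hyp: "FLe_seq {\<psi>. K {} \<psi>} {#} (Some \<phi>)" if "\<phi> \<in> instances Ax" for \<phi>
    using that * theorem_subst[OF assms] by (auto simp: instances_def intro: FLe_seq.Hyp)
  have "K {} \<phi>" if "FLe_seq (instances Ax) {#} (Some \<phi>)" for \<phi>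
    unfolding theorem_iff_seq[OF assms, of \<phi>] using that by (rule FLe_seq_theory) (rule hyp)
  then show "add_axioms FLe Ax \<le> K"
    unfolding logic_le_iff[OF sub assms] by (simp add: add_axioms_def FLe_def)
qed

text \<open>Adding the axioms of \<open>K\<close> to those of a larger \<open>L\<close> leaves
  \<open>L\<close> unchanged, and presents \<open>L\<close> as \<open>K\<close> with further
  axioms.\<close>

lemma axiomatic_extension_iff_le:
  assumes "substructural_logic K" "substructural_logic L"
  shows "axiomatic_extension K L \<longleftrightarrow> K \<le> L"
proof
  assume "axiomatic_extension K L"
  then obtain B where L: "L = add_axioms K B" unfolding axiomatic_extension_def by blast
  obtain Ax where "K = add_axioms FLe Ax"
    using assms(1) unfolding substructural_logic_def axiomatic_extension_def by blast
  then show "K \<le> L"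
    unfolding L by (auto simp: add_axioms_def FLe_def intro: FLe_seq_mono)
next
  assume le: "K \<le> L"
  obtain A where K: "K = add_axioms FLe A"
    using assms(1) unfolding substructural_logic_def axiomatic_extension_def by blast
  obtain B where L: "L = add_axioms FLe B"
    using assms(2) unfolding substructural_logic_def axiomatic_extension_def by blast
  have sub: "substructural_logic (add_axioms FLe (A \<union> B))"
    by (rule substructural_add_axioms)
  have "L = add_axioms FLe (A \<union> B)"
  proof (rule antisym)
    show "L \<le> add_axioms FLe (A \<union> B)"
      unfolding L by (auto simp: add_axioms_def FLe_def instances_Un intro: FLe_seq_mono)
    have "\<forall>\<phi> \<in> A. L {} \<phi>" using le axioms_le_iff[OF assms(2)] K by blast
    moreover have "\<forall>\<phi> \<in> B. L {} \<phi>" using axioms_le_iff[OF assms(2)] L by blast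
    ultimately show "add_axioms FLe (A \<union> B) \<le> L" by (auto simp: axioms_le_iff[OF assms(2)])
  qed
  then show "axiomatic_extension K L"
    unfolding axiomatic_extension_def K add_axioms_add_axioms by blast
qed

lemmas named_logics = FLew_def IPL_def CPL_def add_axioms_add_axioms

lemma substructural_named:
  "substructural_logic FLew" "substructural_logic IPL" "substructural_logic CPL"
  unfolding named_logics by (rule substructural_add_axioms)+

section \<open>Chains as models of intuitionistic and classical logic\<close>

text \<open>A bounded chain is a Heyting algebra with the Goedel implication, and fusion is read as
  meet. The type \<open>bool\<close> gives the classical truth tables; a longer chain separates
  intuitionistic from classical logic.\<close>

primrec chain_eval :: "(nat \<Rightarrow> 'a :: {linorder, order_bot, order_top}) \<Rightarrow> form \<Rightarrow> 'a" where
  "chain_eval v (Var n) = v n"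
| "chain_eval v (\<phi> \<sqdot>\<and> \<psi>) = min (chain_eval v \<phi>) (chain_eval v \<psi>)"
| "chain_eval v (\<phi> \<sqdot>\<or> \<psi>) = max (chain_eval v \<phi>) (chain_eval v \<psi>)"
| "chain_eval v (\<phi> \<sqdot>\<cdot> \<psi>) = min (chain_eval v \<phi>) (chain_eval v \<psi>)"
| "chain_eval v (\<phi> \<sqdot>\<rightarrow> \<psi>) =
    (if chain_eval v \<phi> \<le> chain_eval v \<psi> then Orderings.top else chain_eval v \<psi>)"
| "chain_eval v Zero = Orderings.bot"
| "chain_eval v One = Orderings.top"

lemma chain_eval_neg:
  "chain_eval v (\<sqdot>\<not> \<phi>) = (if chain_eval v \<phi> = Orderings.bot then Orderings.top else Orderings.bot)"
  by (simp add: Neg_def bot_unique)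

lemma chain_eval_subst: "chain_eval v (subst \<sigma> \<phi>) = chain_eval (chain_eval v \<circ> \<sigma>) \<phi>"
  by (induction \<phi>) auto

text \<open>Speaking of lower bounds \<open>k\<close> of the antecedent avoids forming the meet of a
  multiset. An empty succedent counts as bottom.\<close>

lemma chain_sound:
  assumes "FLe_seq \<Phi> \<Gamma> \<delta>" "\<And>\<phi>. \<phi> \<in> \<Phi> \<Longrightarrow> chain_eval v \<phi> = Orderings.top"
    "\<forall>\<gamma> \<in># \<Gamma>. k \<le> chain_eval v \<gamma>"
  shows "k \<le> (case \<delta> of None \<Rightarrow> Orderings.bot | Some \<phi> \<Rightarrow> chain_eval v \<phi>)"
  using assms
proof (induction arbitrary: k rule: FLe_seq.induct)
  case (ImpR \<phi> \<Gamma> \<psi>)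
  \<comment> \<open>The bound is lowered so that it also lies below the formula that the premise has
    in addition; this is residuation on a chain.\<close>
  have "min k (chain_eval v \<phi>) \<le> chain_eval v \<psi>"
    using ImpR.IH[of "min k (chain_eval v \<phi>)"] ImpR.prems by (auto simp: min_le_iff_disj)
  then show ?case by (auto simp: min_def split: if_splits)
next
  case (ImpL \<Gamma> \<phi> \<psi> \<Delta> \<delta>)
  have "k \<le> chain_eval v \<phi>" using ImpL by auto
  then have "k \<le> chain_eval v \<psi>" using ImpL.prems(2) by (auto split: if_splits)
  then show ?case using ImpL by auto
qed (auto simp: le_max_iff_disj)

lemma IPL_sound:
  assumes "IPL {} \<phi>"
  shows "chain_eval v \<phi> = Orderings.top"
  using assms chain_sound[of "instances ({Var 0 \<sqdot>\<rightarrow> One, Zero \<sqdot>\<rightarrow> Var 0} \<union> {Var 0 \<sqdot>\<rightarrow> Var 0 \<sqdot>\<cdot> Var 0})"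
      "{#}" "Some \<phi>" v Orderings.top]
  unfolding named_logics by (force simp: add_axioms_def FLe_def instances_def chain_eval_subst top_unique)

text \<open>Double negation elimination is valid in the two-element chain, hence the type
  \<open>bool\<close>.\<close>

lemma CPL_sound:
  fixes v :: "nat \<Rightarrow> bool"
  assumes "CPL {} \<phi>"
  shows "chain_eval v \<phi>"
proof -
  let ?Ax = "{Var 0 \<sqdot>\<rightarrow> One, Zero \<sqdot>\<rightarrow> Var 0} \<union> {Var 0 \<sqdot>\<rightarrow> Var 0 \<sqdot>\<cdot> Var 0} \<union> {\<sqdot>\<not> \<sqdot>\<not> Var 0 \<sqdot>\<rightarrow> Var 0}"
  have "FLe_seq (instances ?Ax) {#} (Some \<phi>)"
    using assms unfolding named_logics by (simp add: add_axioms_def FLe_def Un_ac insert_commute)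
  moreover have "chain_eval v \<psi> = Orderings.top" if "\<psi> \<in> instances ?Ax" for \<psi>
    using that by (auto simp: instances_def chain_eval_subst chain_eval_neg)
  ultimately show ?thesis using chain_sound[of "instances ?Ax" "{#}" "Some \<phi>" v Orderings.top] by auto
qed

lemma chain_eval_bool:
  fixes v :: "nat \<Rightarrow> bool"
  shows "chain_eval v (\<phi> \<sqdot>\<and> \<psi>) \<longleftrightarrow> chain_eval v \<phi> \<and> chain_eval v \<psi>"
    "chain_eval v (\<phi> \<sqdot>\<cdot> \<psi>) \<longleftrightarrow> chain_eval v \<phi> \<and> chain_eval v \<psi>"
    "chain_eval v (\<phi> \<sqdot>\<or> \<psi>) \<longleftrightarrow> chain_eval v \<phi> \<or> chain_eval v \<psi>"
    "chain_eval v (\<phi> \<sqdot>\<rightarrow> \<psi>) \<longleftrightarrow> (chain_eval v \<phi> \<longrightarrow> chain_eval v \<psi>)"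
    "chain_eval v (\<sqdot>\<not> \<phi>) \<longleftrightarrow> \<not> chain_eval v \<phi>"
  by (auto simp: min_def max_def chain_eval_neg)

section \<open>Theories with weakening\<close>

text \<open>Fixing a set of hypotheses instead of a logic allows \<open>\<Psi>\<close> to be the set
  of theorems of \<open>CPL\<close> or of any other logic above \<open>FLew\<close>.\<close>

locale weakening =
  fixes \<Psi> :: "form set"
  assumes weak_left: "FLe_seq \<Psi> {#\<phi>#} (Some One)"
    and weak_right: "FLe_seq \<Psi> {#Zero#} (Some \<phi>)"
begin

lemma weaken: "FLe_seq \<Psi> \<Gamma> \<delta> \<Longrightarrow> FLe_seq \<Psi> (add_mset \<phi> \<Gamma>) \<delta>"
  using FLe_seq.Cut[OF weak_left FLe_seq.OneL] by fastforce

lemma weaken_mset: "FLe_seq \<Psi> \<Gamma> \<delta> \<Longrightarrow> FLe_seq \<Psi> (\<Gamma> + \<Delta>) \<delta>"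
  by (induction \<Delta>) (auto intro: weaken)

lemma weaken_succ: "FLe_seq \<Psi> \<Gamma> None \<Longrightarrow> FLe_seq \<Psi> \<Gamma> (Some \<phi>)"
  using FLe_seq.Cut[OF FLe_seq.ZeroR weak_right] by fastforce

text \<open>The fusion of its members, with \<open>One\<close> for the empty multiset, represents a
  multiset by a single formula. Contraction of formulas thereby reaches multisets.\<close>

lemma fuse: "\<exists>\<gamma>. \<forall>\<Delta> \<delta>. FLe_seq \<Psi> (add_mset \<gamma> \<Delta>) \<delta> \<longleftrightarrow> FLe_seq \<Psi> (\<Gamma> + \<Delta>) \<delta>"
proof (induction \<Gamma>)
  case empty
  show ?case by (rule exI[of _ One]) simp
next
  case (add \<phi> \<Gamma>)
  then obtain \<gamma> where "\<forall>\<Delta> \<delta>. FLe_seq \<Psi> (add_mset \<gamma> \<Delta>) \<delta> \<longleftrightarrow> FLe_seq \<Psi> (\<Gamma> + \<Delta>) \<delta>" by blast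
  then show ?case
    by (intro exI[of _ "\<gamma> \<sqdot>\<cdot> \<phi>"]) simp
qed

end

text \<open>
  In this situation refutability \<open>\<Gamma> \<Rightarrow>\<close> only depends on the set underlying \<open>\<Gamma>\<close>, so that it is
  classical refutability.
\<close>

locale refutation_contraction = weakening +
  assumes contract: "FLe_seq \<Psi> {#\<phi>, \<phi>#} None \<Longrightarrow> FLe_seq \<Psi> {#\<phi>#} None"
begin

text \<open>The assumption \<open>contract\<close> concerns an antecedent made of two copies of one
  formula and nothing else, so the whole of \<open>\<Gamma>\<close> is first fused into one
  formula.\<close>

lemma contract_double: "FLe_seq \<Psi> (\<Gamma> + \<Gamma>) None \<Longrightarrow> FLe_seq \<Psi> \<Gamma> None"
proof -
  assume *: "FLe_seq \<Psi> (\<Gamma> + \<Gamma>) None"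
  obtain \<gamma> where \<gamma>: "\<forall>\<Delta> \<delta>. FLe_seq \<Psi> (add_mset \<gamma> \<Delta>) \<delta> \<longleftrightarrow> FLe_seq \<Psi> (\<Gamma> + \<Delta>) \<delta>"
    using fuse by blast
  then have "FLe_seq \<Psi> {#\<gamma>, \<gamma>#} None"
    using * by (metis add.commute add_mset_add_single union_mset_add_mset_right)
  then show ?thesis using contract[of \<gamma>] \<gamma> by (metis add.right_neutral)
qed

text \<open>All of \<open>\<Delta>\<close> is added by weakening; then the members of
  \<open>\<Gamma>\<close>, which occur in \<open>\<Delta>\<close> anyway, are absorbed one by
  one.\<close>

lemma refute_mono:
  assumes "FLe_seq \<Psi> \<Gamma> None" "set_mset \<Gamma> \<subseteq> set_mset \<Delta>"
  shows "FLe_seq \<Psi> \<Delta> None"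
proof -
  have absorb: "FLe_seq \<Psi> \<Delta> None" if "FLe_seq \<Psi> (\<Gamma> + \<Delta>) None" "set_mset \<Gamma> \<subseteq> set_mset \<Delta>" for \<Gamma>
    using that
  proof (induction \<Gamma>)
    case (add \<phi> \<Gamma>)
    obtain \<Delta>' where \<Delta>': "\<Delta> = add_mset \<phi> \<Delta>'"
      using add.prems(2) by (metis insert_subset mset_add set_mset_add_mset_insert)
    \<comment> \<open>The surplus \<open>\<phi>\<close> is taken as the \<open>\<phi>\<close> of a
      second copy of \<open>\<Delta>\<close>. Weakening completes that copy to a second
      \<open>\<Gamma> + \<Delta>\<close>, and the doubled context is contracted.\<close>
    have "FLe_seq \<Psi> (add_mset \<phi> (\<Gamma> + \<Delta>) + (\<Gamma> + \<Delta>')) None"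
      using add.prems(1) weaken_mset by fastforce
    then have "FLe_seq \<Psi> ((\<Gamma> + \<Delta>) + (\<Gamma> + \<Delta>)) None"
      by (simp add: \<Delta>')
    then have "FLe_seq \<Psi> (\<Gamma> + \<Delta>) None" by (rule contract_double)
    then show ?case using add.IH add.prems(2) by simp
  qed auto
  show ?thesis using assms weaken_mset absorb by blast
qed

section \<open>Refutability of sets of formulas\<close>

definition refutable :: "form set \<Rightarrow> bool"
  where "refutable S \<longleftrightarrow> (\<exists>\<Gamma>. set_mset \<Gamma> \<subseteq> S \<and> FLe_seq \<Psi> \<Gamma> None)"

lemma refutableI: "FLe_seq \<Psi> \<Gamma> None \<Longrightarrow> set_mset \<Gamma> \<subseteq> S \<Longrightarrow> refutable S"
  unfolding refutable_def by blast

lemma refutable_mono: "refutable S \<Longrightarrow> S \<subseteq> T \<Longrightarrow> refutable T"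
  unfolding refutable_def by blast

text \<open>All occurrences of \<open>\<phi>\<close> are merged into one, and one is supplied if
  there is none; \<open>refute_mono\<close> covers both.\<close>

lemma refutable_insertE:
  assumes "refutable (insert \<phi> S)"
  obtains \<Gamma> where "set_mset \<Gamma> \<subseteq> S" "FLe_seq \<Psi> (add_mset \<phi> \<Gamma>) None"
proof -
  obtain \<Gamma> where \<Gamma>: "set_mset \<Gamma> \<subseteq> insert \<phi> S" "FLe_seq \<Psi> \<Gamma> None"
    using assms unfolding refutable_def by blast
  have "FLe_seq \<Psi> (add_mset \<phi> (filter_mset (\<lambda>x. x \<noteq> \<phi>) \<Gamma>)) None"
    by (rule refute_mono[OF \<Gamma>(2)]) auto
  then show ?thesis using that[of "filter_mset (\<lambda>x. x \<noteq> \<phi>) \<Gamma>"] \<Gamma>(1) by auto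
qed

text \<open>A refutation of \<open>\<phi>\<close> with \<open>\<Gamma>\<close> derives
  \<open>\<sqdot>\<not> \<phi>\<close> from \<open>\<Gamma>\<close>, which is cut against the other
  refutation. Case distinction is thus sound for refutations although excluded middle need not be
  derivable.\<close>

lemma refutable_cases:
  assumes "refutable (insert \<phi> S)" "refutable (insert (\<sqdot>\<not> \<phi>) S)"
  shows "refutable S"
proof -
  obtain \<Gamma> where \<Gamma>: "set_mset \<Gamma> \<subseteq> S" "FLe_seq \<Psi> (add_mset \<phi> \<Gamma>) None"
    using assms(1) by (rule refutable_insertE)
  obtain \<Delta> where \<Delta>: "set_mset \<Delta> \<subseteq> S" "FLe_seq \<Psi> (add_mset (\<sqdot>\<not> \<phi>) \<Delta>) None"
    using assms(2) by (rule refutable_insertE)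
  have "FLe_seq \<Psi> (\<Gamma> + \<Delta>) None"
    using FLe_seq.Cut[of \<Psi> \<Gamma> "\<sqdot>\<not> \<phi>"] \<Gamma>(2) \<Delta>(2) by simp
  then show ?thesis by (rule refutableI) (use \<Gamma>(1) \<Delta>(1) in auto)
qed

lemma refutable_compl: "\<phi> \<in> S \<Longrightarrow> \<sqdot>\<not> \<phi> \<in> S \<Longrightarrow> refutable S"
  by (rule refutableI[OF seq_id2(1)]) auto

text \<open>Together these sets encode the truth tables: each combines values of the components with
  the wrong value of the compound. Most follow because whatever derives a formula refutes its
  negation.\<close>

lemma refutable_connectives:
  "refutable {\<sqdot>\<not> (\<phi> \<sqdot>\<and> \<psi>), \<phi>, \<psi>}" "refutable {\<phi> \<sqdot>\<and> \<psi>, \<sqdot>\<not> \<phi>}" "refutable {\<phi> \<sqdot>\<and> \<psi>, \<sqdot>\<not> \<psi>}"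
  "refutable {\<sqdot>\<not> (\<phi> \<sqdot>\<cdot> \<psi>), \<phi>, \<psi>}" "refutable {\<phi> \<sqdot>\<cdot> \<psi>, \<sqdot>\<not> \<phi>}" "refutable {\<phi> \<sqdot>\<cdot> \<psi>, \<sqdot>\<not> \<psi>}"
  "refutable {\<sqdot>\<not> (\<phi> \<sqdot>\<or> \<psi>), \<phi>}" "refutable {\<sqdot>\<not> (\<phi> \<sqdot>\<or> \<psi>), \<psi>}" "refutable {\<phi> \<sqdot>\<or> \<psi>, \<sqdot>\<not> \<phi>, \<sqdot>\<not> \<psi>}"
  "refutable {\<sqdot>\<not> (\<phi> \<sqdot>\<rightarrow> \<psi>), \<sqdot>\<not> \<phi>}" "refutable {\<sqdot>\<not> (\<phi> \<sqdot>\<rightarrow> \<psi>), \<psi>}" "refutable {\<phi> \<sqdot>\<rightarrow> \<psi>, \<phi>, \<sqdot>\<not> \<psi>}"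
  "refutable {Zero}" "refutable {\<sqdot>\<not> One}"
proof -
  have neg: "FLe_seq \<Psi> (add_mset (\<sqdot>\<not> \<chi>) \<Gamma>) None" if "FLe_seq \<Psi> \<Gamma> (Some \<chi>)" for \<chi> \<Gamma>
    using FLe_seq.Cut[OF that seq_id2(1)] by simp
  have id: "FLe_seq \<Psi> (add_mset \<chi> \<Gamma>) (Some \<chi>)" for \<chi> \<Gamma>
    using weaken_mset[OF FLe_seq.Id] by fastforce
  note id' = id[of \<psi> "{#\<phi>#}", unfolded add_mset_commute[of \<psi> \<phi>]]
  show "refutable {\<sqdot>\<not> (\<phi> \<sqdot>\<and> \<psi>), \<phi>, \<psi>}"
    by (rule refutableI[OF neg[of "{#\<phi>, \<psi>#}" "\<phi> \<sqdot>\<and> \<psi>"]]) (auto intro: id id')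
  show "refutable {\<phi> \<sqdot>\<and> \<psi>, \<sqdot>\<not> \<phi>}"
    by (rule refutableI[OF neg[of "{#\<phi> \<sqdot>\<and> \<psi>#}" \<phi>]]) (auto intro: FLe_seq.AndL1 id)
  show "refutable {\<phi> \<sqdot>\<and> \<psi>, \<sqdot>\<not> \<psi>}"
    by (rule refutableI[OF neg[of "{#\<phi> \<sqdot>\<and> \<psi>#}" \<psi>]]) (auto intro: FLe_seq.AndL2 id)
  show "refutable {\<sqdot>\<not> (\<phi> \<sqdot>\<cdot> \<psi>), \<phi>, \<psi>}"
    by (rule refutableI[OF neg[of "{#\<phi>, \<psi>#}" "\<phi> \<sqdot>\<cdot> \<psi>"]])
      (auto simp flip: seq_fus intro: id)
  show "refutable {\<phi> \<sqdot>\<cdot> \<psi>, \<sqdot>\<not> \<phi>}"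
    by (rule refutableI[OF neg[of "{#\<phi> \<sqdot>\<cdot> \<psi>#}" \<phi>]]) (auto intro: id)
  show "refutable {\<phi> \<sqdot>\<cdot> \<psi>, \<sqdot>\<not> \<psi>}"
    by (rule refutableI[OF neg[of "{#\<phi> \<sqdot>\<cdot> \<psi>#}" \<psi>]]) (auto intro: id')
  show "refutable {\<sqdot>\<not> (\<phi> \<sqdot>\<or> \<psi>), \<phi>}"
    by (rule refutableI[OF neg[of "{#\<phi>#}" "\<phi> \<sqdot>\<or> \<psi>"]]) (auto intro: FLe_seq.OrR1 id)
  show "refutable {\<sqdot>\<not> (\<phi> \<sqdot>\<or> \<psi>), \<psi>}"
    by (rule refutableI[OF neg[of "{#\<psi>#}" "\<phi> \<sqdot>\<or> \<psi>"]]) (auto intro: FLe_seq.OrR2 id)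
  show "refutable {\<phi> \<sqdot>\<or> \<psi>, \<sqdot>\<not> \<phi>, \<sqdot>\<not> \<psi>}"
    by (rule refutableI[of "{#\<phi> \<sqdot>\<or> \<psi>, \<sqdot>\<not> \<phi>, \<sqdot>\<not> \<psi>#}"])
      (auto intro!: refute_mono[OF seq_id2(1)])
  show "refutable {\<sqdot>\<not> (\<phi> \<sqdot>\<rightarrow> \<psi>), \<sqdot>\<not> \<phi>}"
    by (rule refutableI[OF neg[of "{#\<sqdot>\<not> \<phi>#}" "\<phi> \<sqdot>\<rightarrow> \<psi>"]]) (auto intro: weaken_succ seq_id2)
  show "refutable {\<sqdot>\<not> (\<phi> \<sqdot>\<rightarrow> \<psi>), \<psi>}"
    by (rule refutableI[OF neg[of "{#\<psi>#}" "\<phi> \<sqdot>\<rightarrow> \<psi>"]]) (auto intro: id')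
  have "FLe_seq \<Psi> (add_mset \<phi> {#\<phi> \<sqdot>\<rightarrow> \<psi>#}) (Some \<psi>)"
    by (rule seq_imp[THEN iffD1, OF FLe_seq.Id])
  then show "refutable {\<phi> \<sqdot>\<rightarrow> \<psi>, \<phi>, \<sqdot>\<not> \<psi>}"
    by (rule refutableI[OF neg]) auto
  show "refutable {Zero}"
    by (rule refutableI[OF FLe_seq.ZeroL]) auto
  show "refutable {\<sqdot>\<not> One}"
    by (rule refutableI[OF neg[OF FLe_seq.OneR]]) auto
qed

section \<open>Kalmar's argument, with formulas signed by their truth values\<close>

definition literal :: "(nat \<Rightarrow> bool) \<Rightarrow> form \<Rightarrow> form"
  where "literal v \<phi> = (if chain_eval v \<phi> then \<phi> else \<sqdot>\<not> \<phi>)"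

text \<open>Kalmar's lemma says that the signed variables entail the signed formula. Here it is
  phrased as removability from refutable sets, since only refutations behave classically. The number
  \<open>n\<close> bounds the variables of \<open>\<phi>\<close>, uniformly in \<open>v\<close> and
  \<open>S\<close>.\<close>

lemma kalmar:
  "\<exists>n. \<forall>v S. (\<forall>i<n. literal v (Var i) \<in> S) \<longrightarrow> refutable (insert (literal v \<phi>) S) \<longrightarrow> refutable S"
proof -
  have step: "\<exists>n. \<forall>v S. (\<forall>i<n. literal v (Var i) \<in> S) \<longrightarrow>
      refutable (insert (literal v \<chi>) S) \<longrightarrow> refutable S"
    if IH: "\<exists>n. \<forall>v S. (\<forall>i<n. literal v (Var i) \<in> S) \<longrightarrow> refutable (insert (literal v \<phi>) S) \<longrightarrow> refutable S"
      "\<exists>n. \<forall>v S. (\<forall>i<n. literal v (Var i) \<in> S) \<longrightarrow> refutable (insert (literal v \<psi>) S) \<longrightarrow> refutable S"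
      and \<chi>: "\<And>v. if chain_eval v \<chi> then refutable {\<sqdot>\<not> \<chi>, literal v \<phi>, literal v \<psi>}
        else refutable {\<chi>, literal v \<phi>, literal v \<psi>}" for \<chi> \<phi> \<psi>
  proof -
    obtain n m where n: "\<forall>v S. (\<forall>i<n. literal v (Var i) \<in> S) \<longrightarrow> refutable (insert (literal v \<phi>) S) \<longrightarrow> refutable S"
      and m: "\<forall>v S. (\<forall>i<m. literal v (Var i) \<in> S) \<longrightarrow> refutable (insert (literal v \<psi>) S) \<longrightarrow> refutable S"
      using IH by blast
    show ?thesis
    proof (intro exI[of _ "max n m"] allI impI)
      fix v S
      assume S: "\<forall>i<max n m. literal v (Var i) \<in> S" and \<chi>S: "refutable (insert (literal v \<chi>) S)"
      \<comment> \<open>With both signed components present, deciding \<open>\<chi>\<close> leaves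
        two cases: the wrong value is excluded by the truth table, the right one by the assumption
        on \<open>S\<close>. The induction hypotheses then remove the components again.\<close>
      let ?S = "insert (literal v \<psi>) (insert (literal v \<phi>) S)"
      have "refutable ?S"
      proof (rule refutable_cases[of \<chi>])
        show "refutable (insert \<chi> ?S)"
          using \<chi>[of v] \<chi>S unfolding literal_def[of v \<chi>]
          by (cases "chain_eval v \<chi>") (simp, erule refutable_mono, blast)+
        show "refutable (insert (\<sqdot>\<not> \<chi>) ?S)"
          using \<chi>[of v] \<chi>S unfolding literal_def[of v \<chi>]
          by (cases "chain_eval v \<chi>") (simp, erule refutable_mono, blast)+
      qed
      then have "refutable (insert (literal v \<phi>) S)" using m[rule_format, of v] S by simp
      then show "refutable S" using n[rule_format, of v] S by simp
    qed
  qed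
  note fill = refutable_connectives[THEN refutable_mono]
  show ?thesis
  proof (induction \<phi>)
    case (Var n)
    \<comment> \<open>The bound must exceed \<open>n\<close>, so that the literal of
      \<open>Var n\<close> is already in \<open>S\<close>.\<close>
    show ?case by (rule exI[of _ "Suc n"]) (auto simp: insert_absorb)
  next
    case (And \<phi> \<psi>)
    show ?case
      by (rule step[OF And]) (auto simp: literal_def chain_eval_bool intro: fill)
  next
    case (Or \<phi> \<psi>)
    show ?case
      by (rule step[OF Or]) (auto simp: literal_def chain_eval_bool intro: fill)
  next
    case (Fus \<phi> \<psi>)
    show ?case
      by (rule step[OF Fus]) (auto simp: literal_def chain_eval_bool intro: fill)
  next
    case (Imp \<phi> \<psi>)
    show ?case
      by (rule step[OF Imp]) (auto simp: literal_def chain_eval_bool simp del: chain_eval.simps intro: fill)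
  next
    case Zero
    show ?case
      by (intro exI[of _ 0] allI impI, rule refutable_cases[of Zero])
        (auto simp: literal_def intro: fill)
  next
    case One
    show ?case
      by (intro exI[of _ 0] allI impI, rule refutable_cases[of One])
        (auto simp: literal_def intro: fill)
  qed
qed

text \<open>The last variable is decided first: both of its values extend the same literals below
  \<open>n\<close>, and the assumption covers both because it ranges over all valuations.\<close>

lemma refutable_literals:
  assumes "\<And>v. refutable (S \<union> (\<lambda>i. literal v (Var i)) ` {..<n})"
  shows "refutable S"
  using assms
proof (induction n)
  case (Suc n)
  have "refutable (S \<union> (\<lambda>i. literal v (Var i)) ` {..<n})" for v
  proof (rule refutable_cases[of "Var n"])
    let ?S = "S \<union> (\<lambda>i. literal v (Var i)) ` {..<n}"
    \<comment> \<open>Changing the value at \<open>n\<close> does not affect the smaller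
      variables.\<close>
    have eq: "(\<lambda>i. literal (v(n := b)) (Var i)) ` {..<n} = (\<lambda>i. literal v (Var i)) ` {..<n}" for b
      by (intro image_cong) (auto simp: literal_def)
    have literals_Suc: "S \<union> (\<lambda>i. literal (v(n := b)) (Var i)) ` {..<Suc n} =
        insert (if b then Var n else \<sqdot>\<not> Var n) ?S" for b
      unfolding lessThan_Suc image_insert eq by (simp add: literal_def)
    show "refutable (insert (Var n) ?S)" "refutable (insert (\<sqdot>\<not> Var n) ?S)"
      using Suc.prems[of "v(n := True)"] Suc.prems[of "v(n := False)"]
      unfolding literals_Suc if_True if_False .
  qed
  then show ?case by (rule Suc.IH)
qed auto

text \<open>Since \<open>\<phi>\<close> is false under every \<open>v\<close>, its signed form is
  its negation and contradicts it. Kalmar's lemma trades this for signed variables, which are then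
  eliminated by cases.\<close>

lemma refute_unsatisfiable:
  assumes "\<And>v. \<not> chain_eval v \<phi>"
  shows "FLe_seq \<Psi> {#\<phi>#} None"
proof -
  obtain n where n: "\<forall>v S. (\<forall>i<n. literal v (Var i) \<in> S) \<longrightarrow>
      refutable (insert (literal v \<phi>) S) \<longrightarrow> refutable S"
    using kalmar by blast
  have "refutable ({\<phi>} \<union> (\<lambda>i. literal v (Var i)) ` {..<n})" for v
  proof (rule n[rule_format, of v])
    show "refutable (insert (literal v \<phi>) ({\<phi>} \<union> (\<lambda>i. literal v (Var i)) ` {..<n}))"
      using assms[of v] by (intro refutable_compl[of \<phi>]) (simp_all add: literal_def)
  qed simp
  then have "refutable {\<phi>}" by (rule refutable_literals)
  then obtain \<Gamma> where "set_mset \<Gamma> \<subseteq> {\<phi>}" "FLe_seq \<Psi> \<Gamma> None"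
    unfolding refutable_def by blast
  then show ?thesis using refute_mono[of \<Gamma> "{#\<phi>#}"] by simp
qed

end

section \<open>The logics \<open>G(CPL)\<close>\<close>

lemma FLew_theorem:
  assumes "substructural_logic L" "FLew \<le> L"
  shows "L {} (\<phi> \<sqdot>\<rightarrow> One)" "L {} (Zero \<sqdot>\<rightarrow> \<phi>)"
proof -
  have "L {} (Var 0 \<sqdot>\<rightarrow> One)" "L {} (Zero \<sqdot>\<rightarrow> Var 0)"
    using assms(2) unfolding FLew_def axioms_le_iff[OF assms(1)] by simp_all
  from this[THEN theorem_subst[OF assms(1), of _ "\<lambda>_. \<phi>"]]
  show "L {} (\<phi> \<sqdot>\<rightarrow> One)" "L {} (Zero \<sqdot>\<rightarrow> \<phi>)" by simp_all
qed

lemma weakening_theorems: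
  assumes "substructural_logic L" "FLew \<le> L"
  shows "weakening {\<psi>. L {} \<psi>}"
proof
  show "FLe_seq {\<psi>. L {} \<psi>} {#\<phi>#} (Some One)" "FLe_seq {\<psi>. L {} \<psi>} {#Zero#} (Some \<phi>)" for \<phi>
    using FLew_theorem[OF assms, of \<phi>] unfolding theorem_iff_seq[OF assms(1), of "_ \<sqdot>\<rightarrow> _"] seq_imp .
qed

lemma CPL_theorem: "CPL {} (\<phi> \<sqdot>\<rightarrow> \<phi> \<sqdot>\<cdot> \<phi>)" "CPL {} (\<sqdot>\<not> \<sqdot>\<not> \<phi> \<sqdot>\<rightarrow> \<phi>)" "FLew \<le> CPL"
proof -
  have "CPL \<le> CPL" ..
  then have *: "CPL {} (Var 0 \<sqdot>\<rightarrow> Var 0 \<sqdot>\<cdot> Var 0)" "CPL {} (\<sqdot>\<not> \<sqdot>\<not> Var 0 \<sqdot>\<rightarrow> Var 0)"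
    "CPL {} (Var 0 \<sqdot>\<rightarrow> One)" "CPL {} (Zero \<sqdot>\<rightarrow> Var 0)"
    using axioms_le_iff[OF substructural_named(3)] unfolding named_logics by auto
  show "CPL {} (\<phi> \<sqdot>\<rightarrow> \<phi> \<sqdot>\<cdot> \<phi>)" "CPL {} (\<sqdot>\<not> \<sqdot>\<not> \<phi> \<sqdot>\<rightarrow> \<phi>)"
    using *(1,2)[THEN theorem_subst[OF substructural_named(3), of _ "\<lambda>_. \<phi>"]] by (simp_all add: Neg_def)
  show "FLew \<le> CPL"
    using *(3,4) unfolding FLew_def axioms_le_iff[OF substructural_named(3)] by simp
qed

text \<open>For completeness, the contraction axiom yields contraction of refutations, so the
  negation of a tautology is refuted. Double negation elimination then recovers the
  tautology.\<close>

lemma CPL_iff: "CPL {} \<phi> \<longleftrightarrow> (\<forall>v :: nat \<Rightarrow> bool. chain_eval v \<phi>)"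
proof
  show "\<forall>v :: nat \<Rightarrow> bool. chain_eval v \<phi>" if "CPL {} \<phi>"
    using CPL_sound[OF that] by simp
next
  let ?\<Psi> = "{\<psi>. CPL {} \<psi>}"
  note seq = theorem_iff_seq[OF substructural_named(3), THEN iffD1]
  interpret weakening ?\<Psi>
    by (rule weakening_theorems[OF substructural_named(3) CPL_theorem(3)])
  interpret refutation_contraction ?\<Psi>
  proof
    fix \<phi>
    assume "FLe_seq ?\<Psi> {#\<phi>, \<phi>#} None"
    then have "FLe_seq ?\<Psi> {#\<phi> \<sqdot>\<cdot> \<phi>#} None" by simp
    moreover have "FLe_seq ?\<Psi> {#\<phi>#} (Some (\<phi> \<sqdot>\<cdot> \<phi>))"
      using seq[OF CPL_theorem(1)] unfolding seq_imp .
    ultimately show "FLe_seq ?\<Psi> {#\<phi>#} None" using seq_trans by blast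
  qed
  assume "\<forall>v :: nat \<Rightarrow> bool. chain_eval v \<phi>"
  then have "FLe_seq ?\<Psi> {#\<sqdot>\<not> \<phi>#} None"
    by (intro refute_unsatisfiable) (simp add: chain_eval_bool)
  then have "FLe_seq ?\<Psi> {#} (Some (\<sqdot>\<not> \<sqdot>\<not> \<phi>))" by simp
  moreover have "FLe_seq ?\<Psi> {#\<sqdot>\<not> \<sqdot>\<not> \<phi>#} (Some \<phi>)"
    using seq[OF CPL_theorem(2)] unfolding seq_imp .
  ultimately have "FLe_seq ?\<Psi> {#} (Some \<phi>)"
    using FLe_seq.Cut[of ?\<Psi> "{#}" "\<sqdot>\<not> \<sqdot>\<not> \<phi>" "{#}"] by simp
  then show "CPL {} \<phi>" by (rule theorem_iff_seq[OF substructural_named(3), THEN iffD2])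
qed

text \<open>Every candidate proves these axioms, so it remains to see that they generate a
  candidate. Being tautologies they stay below \<open>CPL\<close>, where a double negation is a
  theorem only if the formula is.\<close>

lemma G_FLe_CPL_eq: "G_FLe_CPL = add_axioms FLe {\<sqdot>\<not> \<sqdot>\<not> \<phi> | \<phi>. CPL {} \<phi>}" (is "_ = ?G")
  unfolding G_FLe_CPL_def
proof (rule Least_equality)
  have "?G \<le> CPL"
    unfolding axioms_le_iff[OF substructural_named(3)] by (auto simp: CPL_iff chain_eval_bool)
  then have "CPL {} \<phi>" if "?G {} (\<sqdot>\<not> \<sqdot>\<not> \<phi>)" for \<phi>
    using that by (force simp: le_fun_def CPL_iff chain_eval_bool)
  moreover have "?G {} (\<sqdot>\<not> \<sqdot>\<not> \<phi>)" if "CPL {} \<phi>" for \<phi>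
    using that axioms_le_iff[OF substructural_add_axioms, THEN iffD1, OF order_refl] by blast
  ultimately show "substructural_logic ?G \<and> (\<forall>\<phi>. CPL {} \<phi> \<longleftrightarrow> ?G {} (\<sqdot>\<not> \<sqdot>\<not> \<phi>))"
    using substructural_add_axioms by blast
qed (use axioms_le_iff in blast)

lemma G_FLew_CPL_eq:
  "G_FLew_CPL = add_axioms FLe ({\<sqdot>\<not> \<sqdot>\<not> \<phi> | \<phi>. CPL {} \<phi>} \<union> {Var 0 \<sqdot>\<rightarrow> One, Zero \<sqdot>\<rightarrow> Var 0})" (is "_ = ?G")
  unfolding G_FLew_CPL_def
proof (rule Least_equality)
  show "substructural_logic ?G \<and> G_FLe_CPL \<le> ?G \<and> FLew \<le> ?G"
    using axioms_le_iff[OF substructural_add_axioms, THEN iffD1, OF order_refl]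
    unfolding G_FLe_CPL_eq FLew_def axioms_le_iff[OF substructural_add_axioms]
    by (blast intro: substructural_add_axioms)
  show "?G \<le> K" if "substructural_logic K \<and> G_FLe_CPL \<le> K \<and> FLew \<le> K" for K
  proof -
    have K: "substructural_logic K" using that by blast
    show ?thesis using that unfolding G_FLe_CPL_eq FLew_def axioms_le_iff[OF K] by blast
  qed
qed

text \<open>Tautologies and unsatisfiable formulas are exchanged by negation. If
  \<open>\<phi>\<close> is unsatisfiable, then \<open>\<sqdot>\<not> \<phi>\<close> is a tautology,
  and its double negation, a triple negation of \<open>\<phi>\<close>, collapses to
  \<open>\<sqdot>\<not> \<phi>\<close>.\<close>

lemma axiomatic_extension_G_FLew_CPL_iff:
  assumes "substructural_logic L" "FLew \<le> L"
  shows "axiomatic_extension G_FLew_CPL L \<longleftrightarrow>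
    (\<forall>\<phi>. (\<forall>v :: nat \<Rightarrow> bool. \<not> chain_eval v \<phi>) \<longrightarrow> L {} (\<sqdot>\<not> \<phi>))"
proof -
  have "axiomatic_extension G_FLew_CPL L \<longleftrightarrow> G_FLew_CPL \<le> L"
    by (rule axiomatic_extension_iff_le) (simp_all add: G_FLew_CPL_eq substructural_add_axioms assms)
  also have "\<dots> \<longleftrightarrow> (\<forall>\<phi>. CPL {} \<phi> \<longrightarrow> L {} (\<sqdot>\<not> \<sqdot>\<not> \<phi>))"
    unfolding G_FLew_CPL_eq axioms_le_iff[OF assms(1)] using FLew_theorem[OF assms] by auto
  also have "\<dots> \<longleftrightarrow> (\<forall>\<phi>. (\<forall>v :: nat \<Rightarrow> bool. \<not> chain_eval v \<phi>) \<longrightarrow> L {} (\<sqdot>\<not> \<phi>))"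
  proof (intro iffI allI impI)
    fix \<phi>
    assume "\<forall>\<phi>. CPL {} \<phi> \<longrightarrow> L {} (\<sqdot>\<not> \<sqdot>\<not> \<phi>)" "\<forall>v :: nat \<Rightarrow> bool. \<not> chain_eval v \<phi>"
    then have "L {} (\<sqdot>\<not> \<sqdot>\<not> \<sqdot>\<not> \<phi>)" by (simp add: CPL_iff chain_eval_bool)
    then have "FLe_seq {\<psi>. L {} \<psi>} {#\<sqdot>\<not> \<sqdot>\<not> \<phi>#} None"
      unfolding theorem_iff_seq[OF assms(1), of "\<sqdot>\<not> _"] by simp
    moreover have "FLe_seq {\<psi>. L {} \<psi>} {#\<phi>#} (Some (\<sqdot>\<not> \<sqdot>\<not> \<phi>))" by (simp add: seq_id2)
    ultimately have "FLe_seq {\<psi>. L {} \<psi>} {#} (Some (\<sqdot>\<not> \<phi>))" using seq_trans by fastforce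
    then show "L {} (\<sqdot>\<not> \<phi>)" by (rule theorem_iff_seq[OF assms(1), THEN iffD2])
  qed (auto simp: CPL_iff chain_eval_bool)
  finally show ?thesis .
qed

section \<open>Aristotle's and Boethius' theses\<close>

text \<open>A fusion splits its context, so all of \<open>\<Gamma>\<close> goes to the second factor
  and the first is derived outright. For the conjunction, weakening restores \<open>\<Gamma>\<close>
  in the first component.\<close>

lemma (in weakening) connexive_impI:
  assumes "c \<in> {imp_and, imp_fus}" "FLe_seq \<Psi> {#} (Some (\<phi> \<sqdot>\<rightarrow> \<psi>))"
    "FLe_seq \<Psi> \<Gamma> (Some (\<psi> \<sqdot>\<rightarrow> \<sqdot>\<not> \<sqdot>\<not> \<phi>))"
  shows "FLe_seq \<Psi> \<Gamma> (Some (c \<phi> \<psi>))"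
proof -
  have "FLe_seq \<Psi> \<Gamma> (Some (\<phi> \<sqdot>\<rightarrow> \<psi>))" using weaken_mset[OF assms(2), of \<Gamma>] by simp
  then have "FLe_seq \<Psi> \<Gamma> (Some (\<phi> \<Rightarrow>\<^sub>\<and> \<psi>))"
    unfolding imp_and_def using assms(3) by (rule FLe_seq.AndR)
  moreover have "FLe_seq \<Psi> \<Gamma> (Some (\<phi> \<Rightarrow>\<^sub>\<circ> \<psi>))"
    unfolding imp_fus_def using FLe_seq.FusR[OF assms(2,3)] by simp
  ultimately show ?thesis using assms(1) by auto
qed

lemma (in weakening) aristotle_contraction:
  assumes c: "c \<in> {imp_and, imp_fus}"
    and aristotle: "(\<forall>\<phi>. FLe_seq \<Psi> {#} (Some (\<sqdot>\<not> (c \<phi> (\<sqdot>\<not> \<phi>))))) \<or>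
      (\<forall>\<phi>. FLe_seq \<Psi> {#} (Some (\<sqdot>\<not> (c (\<sqdot>\<not> \<phi>) \<phi>))))"
  shows "refutation_contraction \<Psi>"
proof
  fix \<phi>
  assume sq: "FLe_seq \<Psi> {#\<phi>, \<phi>#} None"
  \<comment> \<open>By assumption \<open>\<phi>\<close> entails
    \<open>\<sqdot>\<not> \<phi>\<close>, which contradicts
    \<open>\<sqdot>\<not> \<sqdot>\<not> \<phi>\<close>.\<close>
  have neg: "FLe_seq \<Psi> {#\<phi>, \<sqdot>\<not> \<sqdot>\<not> \<phi>#} None"
    using FLe_seq.Cut[OF _ seq_id2(1), of \<Psi> "{#\<phi>#}" "\<sqdot>\<not> \<phi>"] sq by (simp add: add_mset_commute)
  have "FLe_seq \<Psi> {#\<phi>#} (Some (c \<phi> (\<sqdot>\<not> \<phi>)))"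
    using sq seq_id2(2)[of \<Psi> \<phi>] by (intro connexive_impI[OF c]) (auto intro: weaken)
  \<comment> \<open>The second thesis is applied at \<open>\<sqdot>\<not> \<phi>\<close>, whose
    negation is \<open>\<sqdot>\<not> \<sqdot>\<not> \<phi>\<close>.\<close>
  moreover have "FLe_seq \<Psi> {#\<phi>#} (Some (c (\<sqdot>\<not> \<sqdot>\<not> \<phi>) (\<sqdot>\<not> \<phi>)))"
    using neg seq_id2(2)[of \<Psi> \<phi>] by (intro connexive_impI[OF c]) (auto intro: weaken)
  ultimately show "FLe_seq \<Psi> {#\<phi>#} None"
    using aristotle seq_trans[of \<Psi> \<phi>] by auto
qed

text \<open>Over \<open>bool\<close> both connectives are equivalence, so Aristotle's theses negate
  unsatisfiable formulas. In Boethius' theses both directions end in a negation, thanks to the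
  double negation in the connective, and hence reduce to refutations of pairs.\<close>

lemma connexive_theses:
  assumes "substructural_logic L" "FLew \<le> L" and c: "c \<in> {imp_and, imp_fus}"
    and unsat: "\<forall>\<phi>. (\<forall>v :: nat \<Rightarrow> bool. \<not> chain_eval v \<phi>) \<longrightarrow> L {} (\<sqdot>\<not> \<phi>)"
  shows "L {} (\<sqdot>\<not> (c \<phi> (\<sqdot>\<not> \<phi>)))" "L {} (\<sqdot>\<not> (c (\<sqdot>\<not> \<phi>) \<phi>))"
    "L {} (c (c \<phi> \<psi>) (\<sqdot>\<not> (c \<phi> (\<sqdot>\<not> \<psi>))))" "L {} (c (c \<phi> (\<sqdot>\<not> \<psi>)) (\<sqdot>\<not> (c \<phi> \<psi>)))"
proof -
  let ?\<Psi> = "{\<psi>. L {} \<psi>}"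
  note seq = theorem_iff_seq[OF assms(1)]
  interpret weakening ?\<Psi> by (rule weakening_theorems[OF assms(1,2)])
  have ev: "chain_eval v (c \<phi> \<psi>) \<longleftrightarrow> (chain_eval v \<phi> \<longleftrightarrow> chain_eval v \<psi>)" for v :: "nat \<Rightarrow> bool" and \<phi> \<psi>
    using c by (auto simp: imp_and_def imp_fus_def chain_eval_bool simp del: chain_eval.simps)
  show "L {} (\<sqdot>\<not> (c \<phi> (\<sqdot>\<not> \<phi>)))" "L {} (\<sqdot>\<not> (c (\<sqdot>\<not> \<phi>) \<phi>))"
    by (rule unsat[rule_format]; simp add: ev chain_eval_bool)+
  have refuted: "FLe_seq ?\<Psi> {#\<phi>, \<psi>#} None"
    if "\<And>v :: nat \<Rightarrow> bool. \<not> (chain_eval v \<phi> \<and> chain_eval v \<psi>)" for \<phi> \<psi>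
  proof -
    have "L {} (\<sqdot>\<not> (\<phi> \<sqdot>\<cdot> \<psi>))" using that by (intro unsat[rule_format]) (simp add: chain_eval_bool del: chain_eval.simps)
    then show ?thesis unfolding seq[of "\<sqdot>\<not> _"] by simp
  qed
  show "L {} (c (c \<phi> \<psi>) (\<sqdot>\<not> (c \<phi> (\<sqdot>\<not> \<psi>))))"
    unfolding seq[of "c _ _"] by (rule connexive_impI[OF c]) (auto intro!: refuted simp: ev chain_eval_bool)
  show "L {} (c (c \<phi> (\<sqdot>\<not> \<psi>)) (\<sqdot>\<not> (c \<phi> \<psi>)))"
    unfolding seq[of "c _ _"] by (rule connexive_impI[OF c]) (auto intro!: refuted simp: ev chain_eval_bool)
qed

lemma IPL_imp_not_commutative:
  assumes "c \<in> {imp_and, imp_fus}"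
  shows "\<not> IPL {} (c (Var 0) (Var 1) \<sqdot>\<rightarrow> c (Var 1) (Var 0))"
proof
  assume "IPL {} (c (Var 0) (Var 1) \<sqdot>\<rightarrow> c (Var 1) (Var 0))"
  \<comment> \<open>The value \<open>1\<close> lies strictly between bottom and top, and its double
    negation is top. Hence the implication from \<open>1\<close> to \<open>\<infinity>\<close> is
    top, whereas the reverse one is only \<open>1\<close>.\<close>
  from IPL_sound[OF this, of "\<lambda>n. if n = 0 then 1 else \<infinity> :: enat"] assms show False
    by (auto simp: imp_and_def imp_fus_def chain_eval_neg top_enat_def bot_enat_def split: if_splits)
qed

section \<open>Lindenbaum algebras\<close>

instance form :: countable
  by countable_datatype

text \<open>Formulas are identified up to interderivability. Countability places the classes in the
  prescribed infinite type as codes of chosen representatives.\<close>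

lemma lindenbaum:
  assumes "infinite (UNIV :: 'a set)"
  obtains A :: "'a fle_struct" and e :: "form \<Rightarrow> 'a"
  where "fle_algebra A" "carrier A = range e"
    "\<And>\<phi> \<psi>. e \<phi> \<preceq>\<^bsub>A\<^esub> e \<psi> \<longleftrightarrow> FLe_seq \<Psi> {#\<phi>#} (Some \<psi>)"
    "\<And>\<sigma> \<phi>. fl_eval A (\<lambda>n. e (\<sigma> n)) \<phi> = e (subst \<sigma> \<phi>)"
proof -
  define le where "le \<phi> \<psi> = FLe_seq \<Psi> {#\<phi>#} (Some \<psi>)" for \<phi> \<psi>
  have le_refl: "le \<phi> \<phi>" and le_trans: "le \<phi> \<psi> \<Longrightarrow> le \<psi> \<chi> \<Longrightarrow> le \<phi> \<chi>" for \<phi> \<psi> \<chi>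
    by (auto simp: le_def intro: FLe_seq.Id seq_trans)
  have le_and: "le \<chi> (\<phi> \<sqdot>\<and> \<psi>) \<longleftrightarrow> le \<chi> \<phi> \<and> le \<chi> \<psi>"
    and le_or: "le (\<phi> \<sqdot>\<or> \<psi>) \<chi> \<longleftrightarrow> le \<phi> \<chi> \<and> le \<psi> \<chi>"
    and le_fus: "le (\<phi> \<sqdot>\<cdot> \<psi>) \<chi> \<longleftrightarrow> FLe_seq \<Psi> {#\<phi>, \<psi>#} (Some \<chi>)"
    and le_imp: "le \<chi> (\<phi> \<sqdot>\<rightarrow> \<psi>) \<longleftrightarrow> le (\<chi> \<sqdot>\<cdot> \<phi>) \<psi>" for \<phi> \<psi> \<chi>
    by (simp_all add: le_def add_mset_commute)
  have fus_mono: "le \<phi> \<phi>' \<Longrightarrow> le \<psi> \<psi>' \<Longrightarrow> le (\<phi> \<sqdot>\<cdot> \<psi>) (\<phi>' \<sqdot>\<cdot> \<psi>')" for \<phi> \<phi>' \<psi> \<psi>'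
    using FLe_seq.FusR[of \<Psi> "{#\<phi>#}" \<phi>' "{#\<psi>#}" \<psi>'] by (simp add: le_def add_mset_commute)
  obtain g :: "nat \<Rightarrow> 'a" where g: "inj g"
    using infinite_countable_subset[OF assms] by auto
  \<comment> \<open>Interderivable formulas satisfy the same predicate under \<open>SOME\<close>,
    hence share a representative and its code.\<close>
  define e where "e \<phi> = g (to_nat (SOME \<psi>. le \<phi> \<psi> \<and> le \<psi> \<phi>))" for \<phi>
  have e_eq: "e \<phi> = e \<psi> \<longleftrightarrow> le \<phi> \<psi> \<and> le \<psi> \<phi>" for \<phi> \<psi>
  proof
    assume "e \<phi> = e \<psi>"
    then have "(SOME \<chi>. le \<phi> \<chi> \<and> le \<chi> \<phi>) = (SOME \<chi>. le \<psi> \<chi> \<and> le \<chi> \<psi>)"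
      using g by (simp add: e_def inj_eq)
    then show "le \<phi> \<psi> \<and> le \<psi> \<phi>"
      using someI[of "\<lambda>\<chi>. le \<phi> \<chi> \<and> le \<chi> \<phi>" \<phi>] someI[of "\<lambda>\<chi>. le \<psi> \<chi> \<and> le \<chi> \<psi>" \<psi>]
        le_refl le_trans by metis
  next
    assume "le \<phi> \<psi> \<and> le \<psi> \<phi>"
    then have "(\<lambda>\<chi>. le \<phi> \<chi> \<and> le \<chi> \<phi>) = (\<lambda>\<chi>. le \<psi> \<chi> \<and> le \<chi> \<psi>)" using le_trans by blast
    then show "e \<phi> = e \<psi>" by (simp add: e_def)
  qed
  \<comment> \<open>A class is determined by its consequences, and dually by the formulas that
    entail it. The lattice and monoid laws are checked in this way.\<close>
  have e_up: "e \<phi> = e \<psi>" if "\<And>\<chi>. le \<phi> \<chi> \<longleftrightarrow> le \<psi> \<chi>" for \<phi> \<psi>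
    using that le_refl e_eq by blast
  have e_down: "e \<phi> = e \<psi>" if "\<And>\<chi>. le \<chi> \<phi> \<longleftrightarrow> le \<chi> \<psi>" for \<phi> \<psi>
    using that le_refl e_eq by blast
  define d where "d x = (SOME \<phi>. e \<phi> = x)" for x
  have "e (d (e \<phi>)) = e \<phi>" for \<phi>
    unfolding d_def by (rule someI) simp
  then have d: "le (d (e \<phi>)) \<phi>" "le \<phi> (d (e \<phi>))" for \<phi>
    using e_eq by blast+
  define A where "A = \<lparr>carrier = range e, mult = (\<lambda>x y. e (d x \<sqdot>\<cdot> d y)), one = e One,
    fl_meet = (\<lambda>x y. e (d x \<sqdot>\<and> d y)), fl_join = (\<lambda>x y. e (d x \<sqdot>\<or> d y)),
    fl_imp = (\<lambda>x y. e (d x \<sqdot>\<rightarrow> d y)), fl_zero = e Zero\<rparr>"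
  have d_le: "le (d (e \<phi>)) \<chi> \<longleftrightarrow> le \<phi> \<chi>" "le \<chi> (d (e \<phi>)) \<longleftrightarrow> le \<chi> \<phi>" for \<phi> \<chi>
    using d le_trans by blast+
  have carrier: "carrier A = range e" and one: "\<one>\<^bsub>A\<^esub> = e One" and zero: "fl_zero A = e Zero"
    by (simp_all add: A_def)
  have mult: "e \<phi> \<otimes>\<^bsub>A\<^esub> e \<psi> = e (\<phi> \<sqdot>\<cdot> \<psi>)" for \<phi> \<psi>
    by (simp add: A_def e_eq fus_mono d)
  have meet: "fl_meet A (e \<phi>) (e \<psi>) = e (\<phi> \<sqdot>\<and> \<psi>)" for \<phi> \<psi>
    by (auto simp: A_def le_and d_le intro!: e_down)
  have join: "fl_join A (e \<phi>) (e \<psi>) = e (\<phi> \<sqdot>\<or> \<psi>)" for \<phi> \<psi>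
    by (auto simp: A_def le_or d_le intro!: e_up)
  have imp: "fl_imp A (e \<phi>) (e \<psi>) = e (\<phi> \<sqdot>\<rightarrow> \<psi>)" for \<phi> \<psi>
  proof -
    \<comment> \<open>Residuation moves the antecedent into a fusion, where monotonicity lets the
      representative be exchanged for \<open>\<phi>\<close>.\<close>
    have "le (\<chi> \<sqdot>\<cdot> d (e \<phi>)) \<psi> \<longleftrightarrow> le (\<chi> \<sqdot>\<cdot> \<phi>) \<psi>" for \<chi>
      using fus_mono[OF le_refl d(1)] fus_mono[OF le_refl d(2)] le_trans by blast
    then show ?thesis by (auto simp: A_def le_imp d_le intro!: e_down)
  qed
  note ops = one zero mult meet join imp
  have fl_le: "e \<phi> \<preceq>\<^bsub>A\<^esub> e \<psi> \<longleftrightarrow> le \<phi> \<psi>" for \<phi> \<psi>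
    using le_refl le_and by (auto simp: fl_le_def meet e_eq)
  have "le (\<phi> \<sqdot>\<and> \<psi>) \<phi>" "le \<phi> (\<phi> \<sqdot>\<or> \<psi>)" for \<phi> \<psi>
    using le_refl le_and le_or by blast+
  then have absorb: "e (\<phi> \<sqdot>\<and> (\<phi> \<sqdot>\<or> \<psi>)) = e \<phi>" "e (\<phi> \<sqdot>\<or> (\<phi> \<sqdot>\<and> \<psi>)) = e \<phi>" for \<phi> \<psi>
    using le_refl by (simp_all add: e_eq le_and le_or)
  have and_lattice: "e (\<phi> \<sqdot>\<and> \<psi>) = e (\<psi> \<sqdot>\<and> \<phi>)"
    "e ((\<phi> \<sqdot>\<and> \<psi>) \<sqdot>\<and> \<chi>) = e (\<phi> \<sqdot>\<and> (\<psi> \<sqdot>\<and> \<chi>))" for \<phi> \<psi> \<chi>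
    by (auto intro!: e_down simp: le_and)
  have or_lattice: "e (\<phi> \<sqdot>\<or> \<psi>) = e (\<psi> \<sqdot>\<or> \<phi>)"
    "e ((\<phi> \<sqdot>\<or> \<psi>) \<sqdot>\<or> \<chi>) = e (\<phi> \<sqdot>\<or> (\<psi> \<sqdot>\<or> \<chi>))" for \<phi> \<psi> \<chi>
    by (auto intro!: e_up simp: le_or)
  have monoid: "e (\<phi> \<sqdot>\<cdot> \<psi>) = e (\<psi> \<sqdot>\<cdot> \<phi>)" "e ((\<phi> \<sqdot>\<cdot> \<psi>) \<sqdot>\<cdot> \<chi>) = e (\<phi> \<sqdot>\<cdot> (\<psi> \<sqdot>\<cdot> \<chi>))"
    "e (One \<sqdot>\<cdot> \<phi>) = e \<phi>" "e (\<phi> \<sqdot>\<cdot> One) = e \<phi>" for \<phi> \<psi> \<chi>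
  proof -
    have right: "FLe_seq \<Psi> {#\<phi>, \<psi> \<sqdot>\<cdot> \<chi>#} \<delta> \<longleftrightarrow> FLe_seq \<Psi> {#\<psi>, \<chi>, \<phi>#} \<delta>" for \<delta>
      by (simp add: add_mset_commute[of \<phi> "\<psi> \<sqdot>\<cdot> \<chi>"])
    show "e ((\<phi> \<sqdot>\<cdot> \<psi>) \<sqdot>\<cdot> \<chi>) = e (\<phi> \<sqdot>\<cdot> (\<psi> \<sqdot>\<cdot> \<chi>))"
      by (rule e_up) (simp add: le_fus right, simp add: add_mset_commute)
  qed (auto intro!: e_up simp: le_def add_mset_commute)
  have "fle_algebra A"
  proof
  qed (auto simp: carrier ops fl_le le_imp absorb monoid(2-4) intro: monoid(1) and_lattice or_lattice)
  moreover have "fl_eval A (\<lambda>n. e (\<sigma> n)) \<phi> = e (subst \<sigma> \<phi>)" for \<sigma> \<phi>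
    by (induction \<phi>) (simp_all add: ops)
  ultimately show ?thesis using that carrier fl_le unfolding le_def by blast
qed

lemma lindenbaum_in_variety:
  fixes L :: logic and c :: "form \<Rightarrow> form \<Rightarrow> form"
  assumes "substructural_logic L" "c \<in> {imp_and, imp_fus}" "infinite (UNIV :: 'a set)"
  obtains A :: "'a fle_struct" and e :: "form \<Rightarrow> 'a"
  where "A \<in> \<V> L" "carrier A = range e" "\<And>\<phi>. \<one>\<^bsub>A\<^esub> \<preceq>\<^bsub>A\<^esub> e \<phi> \<longleftrightarrow> L {} \<phi>"
    "\<And>\<phi> \<psi>. e \<phi> \<preceq>\<^bsub>A\<^esub> e \<psi> \<longleftrightarrow> L {} (\<phi> \<sqdot>\<rightarrow> \<psi>)"
    "\<And>\<phi>. fl_neg A (e \<phi>) = e (\<sqdot>\<not> \<phi>)" "\<And>\<phi> \<psi>. fl_op A c (e \<phi>) (e \<psi>) = e (c \<phi> \<psi>)"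
proof -
  note seq = theorem_iff_seq[OF assms(1)]
  obtain A :: "'a fle_struct" and e :: "form \<Rightarrow> 'a"
    where A: "fle_algebra A" "carrier A = range e"
      and le: "\<And>\<phi> \<psi>. e \<phi> \<preceq>\<^bsub>A\<^esub> e \<psi> \<longleftrightarrow> FLe_seq {\<psi>. L {} \<psi>} {#\<phi>#} (Some \<psi>)"
      and eval: "\<And>\<sigma> \<phi>. fl_eval A (\<lambda>n. e (\<sigma> n)) \<phi> = e (subst \<sigma> \<phi>)"
    using lindenbaum[OF assms(3), of "{\<psi>. L {} \<psi>}"] by blast
  have one: "\<one>\<^bsub>A\<^esub> = e One"
    using eval[of Var One] by simp
  have le_one: "\<one>\<^bsub>A\<^esub> \<preceq>\<^bsub>A\<^esub> e \<phi> \<longleftrightarrow> L {} \<phi>" for \<phi>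
    unfolding seq[of \<phi>] by (simp add: one le)
  have "\<one>\<^bsub>A\<^esub> \<preceq>\<^bsub>A\<^esub> fl_eval A v \<phi>" if "L {} \<phi>" and v: "range v \<subseteq> carrier A" for v \<phi>
  proof -
    \<comment> \<open>A valuation in this algebra is a substitution followed by \<open>e\<close>, so
      validity of theorems is their closure under substitution.\<close>
    obtain \<sigma> where "v = (\<lambda>n. e (\<sigma> n))"
      using v unfolding A(2) by (metis f_inv_into_f rangeI subsetD)
    then show ?thesis using theorem_subst[OF assms(1) that(1)] by (simp add: eval le_one)
  qed
  then have "A \<in> \<V> L" using A(1) by (simp add: variety_def)
  moreover have "e \<phi> \<preceq>\<^bsub>A\<^esub> e \<psi> \<longleftrightarrow> L {} (\<phi> \<sqdot>\<rightarrow> \<psi>)" for \<phi> \<psi>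
    unfolding seq[of "_ \<sqdot>\<rightarrow> _"] by (simp add: le)
  moreover have "fl_neg A (e \<phi>) = e (\<sqdot>\<not> \<phi>)" for \<phi>
    using eval[of "\<lambda>_. \<phi>" "\<sqdot>\<not> Var 0"] by (simp add: fl_neg_def Neg_def)
  moreover have "fl_op A c (e \<phi>) (e \<psi>) = e (c \<phi> \<psi>)" for \<phi> \<psi>
  proof -
    have "fl_op A c (e \<phi>) (e \<psi>) = e (subst (\<lambda>n. if n = 0 then \<phi> else \<psi>) (c (Var 0) (Var 1)))"
      unfolding fl_op_def eval[symmetric] by (simp add: if_distrib)
    also have "\<dots> = e (c \<phi> \<psi>)" using assms(2) by (auto simp: imp_and_def imp_fus_def Neg_def)
    finally show ?thesis .
  qed
  ultimately show ?thesis using that A(2) le_one by blast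
qed

text \<open>Both connectives are built from terms, so the theses in two variables, evaluated at
  \<open>x\<close> and \<open>y\<close>, already give the required inequalities.\<close>

lemma proto_connexiveI:
  assumes c: "c \<in> {imp_and, imp_fus}"
    and "L {} (\<sqdot>\<not> (c (Var 0) (\<sqdot>\<not> Var 0)))" "L {} (\<sqdot>\<not> (c (\<sqdot>\<not> Var 0) (Var 0)))"
    "L {} (c (c (Var 0) (Var 1)) (\<sqdot>\<not> (c (Var 0) (\<sqdot>\<not> Var 1))))"
    "L {} (c (c (Var 0) (\<sqdot>\<not> Var 1)) (\<sqdot>\<not> (c (Var 0) (Var 1))))"
  shows "proto_connexive TYPE('a) L c"
  unfolding proto_connexive_def Let_def
proof (intro ballI)
  fix A :: "'a fle_struct" and x y
  assume A: "A \<in> \<V> L" and xy: "x \<in> carrier A" "y \<in> carrier A"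
  define v where "v n = (if n = 0 then x else y)" for n :: nat
  have valid: "\<one>\<^bsub>A\<^esub> \<preceq>\<^bsub>A\<^esub> fl_eval A v \<phi>" if "L {} \<phi>" for \<phi>
  proof -
    have "range v \<subseteq> carrier A" using xy by (auto simp: v_def)
    then show ?thesis using A that by (simp add: variety_def)
  qed
  have op: "fl_eval A v (c \<phi> \<psi>) = fl_op A c (fl_eval A v \<phi>) (fl_eval A v \<psi>)"
    and neg: "fl_eval A v (\<sqdot>\<not> \<phi>) = fl_neg A (fl_eval A v \<phi>)" for \<phi> \<psi>
    using c by (auto simp: fl_op_def imp_and_def imp_fus_def Neg_def fl_neg_def)
  have "fl_eval A v (Var 0) = x" "fl_eval A v (Var 1) = y"
    by (simp_all add: v_def)
  then show "\<one>\<^bsub>A\<^esub> \<preceq>\<^bsub>A\<^esub> fl_neg A (fl_op A c x (fl_neg A x)) \<and>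
      \<one>\<^bsub>A\<^esub> \<preceq>\<^bsub>A\<^esub> fl_neg A (fl_op A c (fl_neg A x) x) \<and>
      \<one>\<^bsub>A\<^esub> \<preceq>\<^bsub>A\<^esub> fl_op A c (fl_op A c x y) (fl_neg A (fl_op A c x (fl_neg A y))) \<and>
      \<one>\<^bsub>A\<^esub> \<preceq>\<^bsub>A\<^esub> fl_op A c (fl_op A c x (fl_neg A y)) (fl_neg A (fl_op A c x y))"
    using assms(2-5)[THEN valid] unfolding op neg by simp
qed

theorem theorem3p29:
  fixes L :: logic and c :: "form \<Rightarrow> form \<Rightarrow> form"
  assumes "substructural_logic L" and "FLew \<le> L" and "L \<le> IPL"
    and "c \<in> {imp_and, imp_fus}"
    and "infinite (UNIV :: 'a set)"
  shows "(connexive TYPE('a) L c \<longleftrightarrow>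
           (\<forall>\<phi>. L {} (\<sqdot>\<not> (c \<phi> (\<sqdot>\<not> \<phi>)))) \<or> (\<forall>\<phi>. L {} (\<sqdot>\<not> (c (\<sqdot>\<not> \<phi>) \<phi>))))
       \<and> ((\<forall>\<phi>. L {} (\<sqdot>\<not> (c \<phi> (\<sqdot>\<not> \<phi>)))) \<or> (\<forall>\<phi>. L {} (\<sqdot>\<not> (c (\<sqdot>\<not> \<phi>) \<phi>)))
           \<longleftrightarrow> axiomatic_extension G_FLew_CPL L)"
proof -
  let ?aristotle = "(\<forall>\<phi>. L {} (\<sqdot>\<not> (c \<phi> (\<sqdot>\<not> \<phi>)))) \<or> (\<forall>\<phi>. L {} (\<sqdot>\<not> (c (\<sqdot>\<not> \<phi>) \<phi>)))"
  let ?glivenko = "\<forall>\<phi>. (\<forall>v :: nat \<Rightarrow> bool. \<not> chain_eval v \<phi>) \<longrightarrow> L {} (\<sqdot>\<not> \<phi>)"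
  let ?\<Psi> = "{\<psi>. L {} \<psi>}"
  note seq = theorem_iff_seq[OF assms(1)]
  obtain A :: "'a fle_struct" and e :: "form \<Rightarrow> 'a"
    where A: "A \<in> \<V> L" "carrier A = range e" "\<And>\<phi>. \<one>\<^bsub>A\<^esub> \<preceq>\<^bsub>A\<^esub> e \<phi> \<longleftrightarrow> L {} \<phi>"
      and le: "\<And>\<phi> \<psi>. e \<phi> \<preceq>\<^bsub>A\<^esub> e \<psi> \<longleftrightarrow> L {} (\<phi> \<sqdot>\<rightarrow> \<psi>)"
      and ops: "\<And>\<phi>. fl_neg A (e \<phi>) = e (\<sqdot>\<not> \<phi>)" "\<And>\<phi> \<psi>. fl_op A c (e \<phi>) (e \<psi>) = e (c \<phi> \<psi>)"
    using lindenbaum_in_variety[OF assms(1,4,5)] by blast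
  \<comment> \<open>Every element of the Lindenbaum algebra is the class of a formula, so the
    validity of the first thesis there makes all its instances theorems.\<close>
  have "?aristotle" if "connexive TYPE('a) L c"
  proof -
    have "\<forall>x \<in> carrier A. \<one>\<^bsub>A\<^esub> \<preceq>\<^bsub>A\<^esub> fl_neg A (fl_op A c x (fl_neg A x))"
      using that A(1) unfolding connexive_def proto_connexive_def Let_def by blast
    then show ?thesis by (simp add: A ops)
  qed
  moreover have "?glivenko" if "?aristotle"
  proof (intro allI impI)
    fix \<phi>
    assume unsat: "\<forall>v :: nat \<Rightarrow> bool. \<not> chain_eval v \<phi>"
    interpret weakening ?\<Psi> by (rule weakening_theorems[OF assms(1,2)])
    interpret refutation_contraction ?\<Psi>
      using that unfolding seq[of "\<sqdot>\<not> _"] by (rule aristotle_contraction[OF assms(4)])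
    show "L {} (\<sqdot>\<not> \<phi>)"
      unfolding seq[of "\<sqdot>\<not> _"] seq_neg by (rule refute_unsatisfiable) (use unsat in blast)
  qed
  moreover have "connexive TYPE('a) L c" if "?glivenko"
  proof -
    note theses = connexive_theses[OF assms(1,2,4) that]
    have "proto_connexive TYPE('a) L c"
      by (rule proto_connexiveI) (rule assms(4) theses)+
    \<comment> \<open>The classes of two distinct variables are the witnesses: equality would make
      symmetry a theorem of \<open>L\<close> and hence of \<open>IPL\<close>.\<close>
    moreover have "fl_op A c (e (Var 0)) (e (Var 1)) \<noteq> fl_op A c (e (Var 1)) (e (Var 0))"
    proof
      assume "fl_op A c (e (Var 0)) (e (Var 1)) = fl_op A c (e (Var 1)) (e (Var 0))"
      then have "e (c (Var 0) (Var 1)) \<preceq>\<^bsub>A\<^esub> e (c (Var 1) (Var 0))"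
        unfolding ops by (simp add: le seq[of "_ \<sqdot>\<rightarrow> _"] FLe_seq.Id)
      then show False using assms(3) IPL_imp_not_commutative[OF assms(4)] by (auto simp: le le_fun_def)
    qed
    ultimately show ?thesis using A(1,2) unfolding connexive_def by blast
  qed
  ultimately show ?thesis
    unfolding axiomatic_extension_G_FLew_CPL_iff[OF assms(1,2)] by blast
qed

end
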